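(* Simon's algorithm can be simulated classically if an arbitrarily small amount of depolarising noise is applied to each qubit at the end of the algorithm (without fault-tolerance). That is, let $\epsilon>0$ and $\delta>0$ be fixed, let $f:\{0,1\}^n\to Y$ be given as an oracle, satisfying the promise of Simon's problem with hidden string $t$, let $p$ be the output distribution of Simon's algorithm, which is uniform over $\{x\in\{0,1\}^n:x\cdot t=0\}$, and let $\widetilde p$ be the distribution obtained when depolarising noise with rate $\epsilon$ is applied independently to each output qubit before measurement. Then there is a classical algorithm, running in time polynomial in $n$ with oracle access to $f$, which samples from a distribution $\widetilde p'$ with $\sum_x|\widetilde p'_x-\widetilde p_x|\le\delta$.
   Context: Simon's problem: given oracle access to a function $f:\{0,1\}^n\to Y$ for some set $Y$, with the promise that there exists $t\in\{0,1\}^n$ such that for distinct $x,y$, $f(x)=f(y)$ if and only if $x+y=t$ (bitwise addition modulo 2), determine $t$. Here $x\cdot t=\sum_ix_it_i$ modulo 2. One run of Simon's quantum algorithm outputs a uniformly random $x$ with $x\cdot t=0$. Depolarising noise with rate $\epsilon$ is the single-qubit channel $\mathcal{D}_\epsilon(\rho)=(1-\epsilon)\rho+\epsilon I/2$; applied to each qubit just before measurement in the computational basis, it is equivalent to sampling $x$ from $p$ and flipping each bit of $x$ independently with probability $\epsilon/2$. *)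

theory Defs
  imports "HOL-Probability.Probability" "HOL-Computational_Algebra.Polynomial"
begin

section \<open>Bit strings and Simon's promise\<close>

definition cube :: "nat \<Rightarrow> bool list set" where
  "cube n = {x. length x = n}"

definition xor :: "bool list \<Rightarrow> bool list \<Rightarrow> bool list" where
  "xor x y = map2 (\<noteq>) x y"

definition dot :: "bool list \<Rightarrow> bool list \<Rightarrow> nat" where
  "dot x y = (\<Sum>i<length x. of_bool (x ! i) * of_bool (y ! i)) mod 2"

text \<open>The string \<open>t\<close> may be zero, in which case \<open>f\<close> is injective on \<open>cube n\<close>.\<close>

definition simon_promise :: "nat \<Rightarrow> (bool list \<Rightarrow> 'y) \<Rightarrow> bool list \<Rightarrow> bool" where
  "simon_promise n f t \<longleftrightarrow> t \<in> cube n \<and>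
     (\<forall>x\<in>cube n. \<forall>y\<in>cube n. x \<noteq> y \<longrightarrow> (f x = f y \<longleftrightarrow> xor x y = t))"


section \<open>Simon's quantum algorithm and depolarising noise\<close>

text \<open>
  States of \<open>n\<close> qubits are amplitude functions on \<open>cube n\<close>.  The second register has an
  orthonormal basis labelled by the values of \<open>f\<close>, and the query unitary sends
  \<open>|x\<rangle>|blank\<rangle>\<close> to \<open>|x\<rangle>|f x\<rangle>\<close>.
\<close>

definition zero_state :: "nat \<Rightarrow> bool list \<Rightarrow> complex" where
  "zero_state n x = of_bool (x = replicate n False)"

definition hadamard :: "nat \<Rightarrow> (bool list \<Rightarrow> complex) \<Rightarrow> bool list \<Rightarrow> complex" where
  "hadamard n \<psi> z = (\<Sum>x\<in>cube n. (-1) ^ dot x z / complex_of_real (sqrt (2 ^ n)) * \<psi> x)"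

definition query_state ::
    "(bool list \<Rightarrow> 'y) \<Rightarrow> (bool list \<Rightarrow> complex) \<Rightarrow> bool list \<Rightarrow> 'y \<Rightarrow> complex" where
  "query_state f \<psi> x y = of_bool (f x = y) * \<psi> x"

definition simon_state :: "nat \<Rightarrow> (bool list \<Rightarrow> 'y) \<Rightarrow> bool list \<Rightarrow> 'y \<Rightarrow> complex" where
  "simon_state n f z y =
     hadamard n (\<lambda>x. query_state f (hadamard n (zero_state n)) x y) z"

text \<open>Reduced density matrix of the first register; the second register is traced out.\<close>

definition simon_density :: "nat \<Rightarrow> (bool list \<Rightarrow> 'y) \<Rightarrow> bool list \<Rightarrow> bool list \<Rightarrow> complex" where
  "simon_density n f z z' =
     (\<Sum>y\<in>f ` cube n. simon_state n f z y * cnj (simon_state n f z' y))"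

text \<open>
  The channel \<open>(1 - \<epsilon>) \<rho> + \<epsilon> I/2\<close> on qubit \<open>i\<close>, tensored with the identity on the other
  qubits: the second summand is \<open>\<epsilon>\<close> times \<open>I/2\<close> on qubit \<open>i\<close> tensored with the partial
  trace of \<open>\<rho>\<close> over qubit \<open>i\<close>.
\<close>

definition depolarise ::
    "real \<Rightarrow> nat \<Rightarrow> (bool list \<Rightarrow> bool list \<Rightarrow> complex) \<Rightarrow> bool list \<Rightarrow> bool list \<Rightarrow> complex" where
  "depolarise \<epsilon> i \<rho> z z' =
     of_real (1 - \<epsilon>) * \<rho> z z' +
     of_real \<epsilon> * (of_bool (z ! i = z' ! i) / 2 * (\<Sum>b\<in>UNIV. \<rho> (z[i := b]) (z'[i := b])))"

definition depolarise_all ::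
    "real \<Rightarrow> nat \<Rightarrow> (bool list \<Rightarrow> bool list \<Rightarrow> complex) \<Rightarrow> bool list \<Rightarrow> bool list \<Rightarrow> complex" where
  "depolarise_all \<epsilon> n \<rho> = fold (depolarise \<epsilon>) [0..<n] \<rho>"

definition measure_prob :: "(bool list \<Rightarrow> bool list \<Rightarrow> complex) \<Rightarrow> bool list \<Rightarrow> real" where
  "measure_prob \<rho> x = Re (\<rho> x x)"

definition simon_output :: "nat \<Rightarrow> (bool list \<Rightarrow> 'y) \<Rightarrow> bool list \<Rightarrow> real" where
  "simon_output n f = measure_prob (simon_density n f)"

definition noisy_simon_output :: "real \<Rightarrow> nat \<Rightarrow> (bool list \<Rightarrow> 'y) \<Rightarrow> bool list \<Rightarrow> real" where
  "noisy_simon_output \<epsilon> n f = measure_prob (depolarise_all \<epsilon> n (simon_density n f))"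


section \<open>Probabilistic oracle RAM programs\<close>

text \<open>
  Random access machine over natural numbers with unit-cost addition and truncated
  subtraction but no multiplication, hence polynomially equivalent to Turing machines
  (numbers have at most linearly many bits in the running time).
  \<open>ans\<close> holds oracle answers; since \<open>Y\<close> is an arbitrary set,
  answers are opaque and can only be compared for equality.
\<close>

datatype program =
    Skip
  | Const nat nat
  | Add nat nat nat
  | Sub nat nat nat
  | Load nat nat
  | Store nat nat
  | Coin nat
  | Query nat nat
  | EqAns nat nat nat
  | Seq program program
  | IfNZ nat program program
  | WhileNZ nat program

record 'y state =
  reg :: "nat \<Rightarrow> nat"
  mem :: "nat \<Rightarrow> nat"
  ans :: "nat \<Rightarrow> 'y option"

definition set_reg :: "nat \<Rightarrow> nat \<Rightarrow> 'y state \<Rightarrow> 'y state" where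
  "set_reg r v s = s\<lparr>reg := (reg s)(r := v)\<rparr>"

definition read_bits :: "nat \<Rightarrow> nat \<Rightarrow> 'y state \<Rightarrow> bool list" where
  "read_bits n a s = map (\<lambda>i. mem s (a + i) \<noteq> 0) [0..<n]"

text \<open>
  One unit of time.  \<open>Query a r\<close> asks for \<open>f\<close> at the \<open>n\<close> bits stored in memory from address
  \<open>reg s r\<close> on.
\<close>

primrec step :: "nat \<Rightarrow> (bool list \<Rightarrow> 'y) \<Rightarrow> program \<Rightarrow> 'y state \<Rightarrow> (program \<times> 'y state) pmf" where
  "step n f Skip s = return_pmf (Skip, s)"
| "step n f (Const r k) s = return_pmf (Skip, set_reg r k s)"
| "step n f (Add r a b) s = return_pmf (Skip, set_reg r (reg s a + reg s b) s)"
| "step n f (Sub r a b) s = return_pmf (Skip, set_reg r (reg s a - reg s b) s)"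
| "step n f (Load r a) s = return_pmf (Skip, set_reg r (mem s (reg s a)) s)"
| "step n f (Store a r) s = return_pmf (Skip, s\<lparr>mem := (mem s)(reg s a := reg s r)\<rparr>)"
| "step n f (Coin r) s =
     map_pmf (\<lambda>b. (Skip, set_reg r (of_bool b) s)) (bernoulli_pmf (1 / 2))"
| "step n f (Query a r) s =
     return_pmf (Skip, s\<lparr>ans := (ans s)(a := Some (f (read_bits n (reg s r) s)))\<rparr>)"
| "step n f (EqAns r a b) s = return_pmf (Skip, set_reg r (of_bool (ans s a = ans s b)) s)"
| "step n f (Seq c d) s =
     (if c = Skip then return_pmf (d, s)
      else map_pmf (\<lambda>(c', s'). (Seq c' d, s')) (step n f c s))"
| "step n f (IfNZ r c d) s = return_pmf (if reg s r \<noteq> 0 then c else d, s)"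
| "step n f (WhileNZ r c) s =
     return_pmf (if reg s r \<noteq> 0 then Seq c (WhileNZ r c) else Skip, s)"

text \<open>Register 0 initially contains \<open>n\<close>; everything else is blank.\<close>

definition init_state :: "nat \<Rightarrow> 'y state" where
  "init_state n = \<lparr>reg = (\<lambda>_. 0)(0 := n), mem = (\<lambda>_. 0), ans = (\<lambda>_. None)\<rparr>"

primrec run :: "nat \<Rightarrow> (bool list \<Rightarrow> 'y) \<Rightarrow> program \<Rightarrow> nat \<Rightarrow> (program \<times> 'y state) pmf" where
  "run n f c 0 = return_pmf (c, init_state n)"
| "run n f c (Suc T) = bind_pmf (run n f c T) (\<lambda>(c', s'). step n f c' s')"

definition halts_within :: "nat \<Rightarrow> (bool list \<Rightarrow> 'y) \<Rightarrow> program \<Rightarrow> nat \<Rightarrow> bool" where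
  "halts_within n f c T \<longleftrightarrow> (\<forall>(c', s')\<in>set_pmf (run n f c T). c' = Skip)"

text \<open>
  The output is read from the first \<open>n\<close> memory cells.  A halted configuration never changes, so
  this is the distribution of the final output whenever \<open>halts_within n f c T\<close>.
\<close>

definition sampled :: "nat \<Rightarrow> (bool list \<Rightarrow> 'y) \<Rightarrow> program \<Rightarrow> nat \<Rightarrow> bool list pmf" where
  "sampled n f c T = map_pmf (\<lambda>(c', s'). read_bits n 0 s') (run n f c T)"


section \<open>Sanity checks\<close>

lemma finite_cube [simp]: "finite (cube n)"
  and card_cube: "card (cube n) = 2 ^ n"
proof -
  have "cube n = {xs. set xs \<subseteq> UNIV \<and> length xs = n}"
    by (simp add: cube_def)
  then show "finite (cube n)" "card (cube n) = 2 ^ n"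
    using finite_lists_length_eq[of "UNIV :: bool set" n] card_lists_length_eq[of "UNIV :: bool set" n]
    by simp_all
qed

lemma xor_in_cube [simp]: "x \<in> cube n \<Longrightarrow> y \<in> cube n \<Longrightarrow> xor x y \<in> cube n"
  by (simp add: cube_def xor_def)

lemma xor_xor [simp]: "x \<in> cube n \<Longrightarrow> y \<in> cube n \<Longrightarrow> xor x (xor x y) = y"
  by (auto simp: cube_def xor_def intro!: nth_equalityI)

lemma xor_eq_iff:
  "x \<in> cube n \<Longrightarrow> y \<in> cube n \<Longrightarrow> t \<in> cube n \<Longrightarrow> xor x y = t \<longleftrightarrow> y = xor x t"
  by (metis xor_xor)

lemma xor_eq_self_iff:
  "x \<in> cube n \<Longrightarrow> t \<in> cube n \<Longrightarrow> xor x t = x \<longleftrightarrow> t = replicate n False"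
  by (auto simp: cube_def xor_def list_eq_iff_nth_eq)

definition sgn_dot :: "bool list \<Rightarrow> bool list \<Rightarrow> complex" where
  "sgn_dot x z = (-1) ^ dot x z"

lemma minus_one_power_mod_2: "(-1 :: 'a :: ring_1) ^ (k mod 2) = (-1) ^ k"
  by (cases "even k") (auto simp: even_iff_mod_2_eq_zero odd_iff_mod_2_eq_one)

lemma sgn_dot_prod:
  "sgn_dot x z = (\<Prod>i<length x. if x ! i \<and> z ! i then -1 else 1)"
  unfolding sgn_dot_def dot_def minus_one_power_mod_2 power_sum
  by (intro prod.cong) auto

lemma sgn_dot_xor:
  assumes "x \<in> cube n" "t \<in> cube n"
  shows "sgn_dot (xor x t) z = sgn_dot x z * sgn_dot t z"
  using assms unfolding sgn_dot_prod prod.distrib[symmetric]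
  by (auto simp: cube_def xor_def prod.distrib[symmetric] intro!: prod.cong)

lemma sgn_dot_square [simp]: "sgn_dot x z * sgn_dot x z = 1"
  by (simp add: sgn_dot_def flip: power_mult_distrib)

lemma sgn_dot_eq: "sgn_dot x z = (if dot x z = 0 then 1 else -1)"
proof -
  have "dot x z < 2" by (simp add: dot_def)
  then have "dot x z = 0 \<or> dot x z = 1" by auto
  then show ?thesis by (auto simp: sgn_dot_def)
qed

lemma sgn_dot_cnj [simp]: "cnj (sgn_dot x z) = sgn_dot x z"
  by (simp add: sgn_dot_eq)

lemma dot_commute: "x \<in> cube n \<Longrightarrow> y \<in> cube n \<Longrightarrow> dot x y = dot y x"
  by (simp add: dot_def cube_def mult.commute)

lemma sum_sgn_dot:
  assumes "t \<in> cube n"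
  shows "(\<Sum>x\<in>cube n. sgn_dot x t) = (if t = replicate n False then 2 ^ n else 0)"
proof (cases "t = replicate n False")
  case True
  have "sgn_dot x t = 1" if "x \<in> cube n" for x
    using that True by (simp add: sgn_dot_prod cube_def)
  then show ?thesis using True by (simp add: card_cube)
next
  case False
  then obtain i where i: "i < n" "t ! i"
    using assms by (auto simp: cube_def list_eq_iff_nth_eq)
  define e where "e = (replicate n False)[i := True]"
  have e: "e \<in> cube n" by (simp add: e_def cube_def)
  have "sgn_dot e t = (\<Prod>j<n. if j = i then -1 else 1)"
    using e i unfolding sgn_dot_prod by (intro prod.cong) (auto simp: cube_def e_def nth_list_update)
  then have et: "sgn_dot e t = -1"
    using i by (simp add: prod.delta)
  have xe: "xor (xor x e) e = x" if "x \<in> cube n" for x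
    using that e by (auto simp: cube_def xor_def intro!: nth_equalityI)
  have "(\<Sum>x\<in>cube n. sgn_dot x t) = (\<Sum>x\<in>cube n. sgn_dot (xor x e) t)"
    by (rule sum.reindex_bij_witness[of _ "\<lambda>x. xor x e" "\<lambda>x. xor x e"]) (use e xe in auto)
  also have "\<dots> = - (\<Sum>x\<in>cube n. sgn_dot x t)"
    using e by (simp add: sgn_dot_xor et sum_negf)
  finally show ?thesis using False by simp
qed

lemma hadamard_zero:
  "hadamard n (zero_state n) z = 1 / complex_of_real (sqrt (2 ^ n))"
proof -
  have r: "replicate n False \<in> cube n" by (simp add: cube_def)
  have "hadamard n (zero_state n) z =
      (\<Sum>x\<in>cube n. if x = replicate n False then sgn_dot x z / complex_of_real (sqrt (2 ^ n)) else 0)"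
    unfolding hadamard_def zero_state_def sgn_dot_def by (intro sum.cong) auto
  also have "\<dots> = sgn_dot (replicate n False) z / complex_of_real (sqrt (2 ^ n))"
    using r by (simp add: sum.delta)
  also have "sgn_dot (replicate n False) z = 1"
    by (simp add: sgn_dot_prod)
  finally show ?thesis .
qed

lemma simon_state_eq:
  "simon_state n f z y = (\<Sum>x\<in>cube n. sgn_dot x z * of_bool (f x = y)) / 2 ^ n"
proof -
  have "complex_of_real (sqrt (2 ^ n)) * complex_of_real (sqrt (2 ^ n)) = 2 ^ n"
    by (simp flip: of_real_mult)
  then have *: "a / complex_of_real (sqrt (2 ^ n)) * (b * (1 / complex_of_real (sqrt (2 ^ n)))) = a * b / 2 ^ n"
    for a b :: complex
    by (metis (no_types, opaque_lifting) mult.right_neutral times_divide_eq_right times_divide_times_eq)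
  show ?thesis
    unfolding simon_state_def query_state_def hadamard_zero
    unfolding hadamard_def sgn_dot_def sum_divide_distrib
    by (intro sum.cong refl *)
qed

lemma simon_density_diag:
  assumes "simon_promise n f t"
  shows "simon_density n f z z =
    (if t = replicate n False then 1 else 1 + sgn_dot t z) / 2 ^ n"
proof -
  have t: "t \<in> cube n" using assms by (simp add: simon_promise_def)
  let ?C = "cube n"
  have "simon_density n f z z =
      (\<Sum>y\<in>f ` ?C. \<Sum>x\<in>?C. \<Sum>x'\<in>?C.
         sgn_dot x z * sgn_dot x' z / 4 ^ n * (if f x = y then of_bool (f x' = f x) else 0))"
    unfolding simon_density_def
  proof (intro sum.cong refl)
    fix y
    have "cnj (simon_state n f z y) = simon_state n f z y"
      by (simp add: simon_state_eq cnj_sum)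
    moreover have "(4 :: complex) ^ n = 2 ^ n * 2 ^ n"
      by (simp flip: power_mult_distrib)
    ultimately have "simon_state n f z y * cnj (simon_state n f z y) =
        (\<Sum>x\<in>?C. \<Sum>x'\<in>?C.
          (sgn_dot x z * of_bool (f x = y)) * (sgn_dot x' z * of_bool (f x' = y))) / 4 ^ n"
      by (simp only: simon_state_eq times_divide_times_eq sum_product)
    also have "\<dots> = (\<Sum>x\<in>?C. \<Sum>x'\<in>?C.
         sgn_dot x z * sgn_dot x' z / 4 ^ n * (if f x = y then of_bool (f x' = f x) else 0))"
      unfolding sum_divide_distrib by (intro sum.cong refl) simp
    finally show "simon_state n f z y * cnj (simon_state n f z y) = \<dots>" .
  qed
  also have "\<dots> = (\<Sum>x\<in>?C. \<Sum>y\<in>f ` ?C. \<Sum>x'\<in>?C.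
         sgn_dot x z * sgn_dot x' z / 4 ^ n * (if f x = y then of_bool (f x' = f x) else 0))"
    by (rule sum.swap)
  also have "\<dots> = (\<Sum>x\<in>?C. \<Sum>x'\<in>?C. \<Sum>y\<in>f ` ?C.
         sgn_dot x z * sgn_dot x' z / 4 ^ n * (if f x = y then of_bool (f x' = f x) else 0))"
    by (rule sum.cong[OF refl], rule sum.swap)
  also have "\<dots> = (\<Sum>x\<in>?C. \<Sum>x'\<in>?C. sgn_dot x z * sgn_dot x' z / 4 ^ n * of_bool (f x' = f x))"
    unfolding sum_distrib_left[symmetric]
  proof (intro sum.cong refl, goal_cases)
    case (1 x x')
    then have "(\<Sum>y\<in>f ` ?C. if f x = y then of_bool (f x' = f x) else 0) = (of_bool (f x' = f x) :: complex)"
      by (subst sum.delta') auto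
    then show ?case by (simp only:)
  qed
  also have "\<dots> = (\<Sum>x\<in>?C. (if t = replicate n False then 1 else 1 + sgn_dot t z) / 4 ^ n)"
  proof (intro sum.cong refl)
    fix x assume x: "x \<in> ?C"
    have eq: "{x'\<in>?C. f x' = f x} = {x, xor x t}"
    proof (intro set_eqI iffI)
      fix x' assume "x' \<in> {x'\<in>?C. f x' = f x}"
      then have x': "x' \<in> ?C" "f x = f x'" by auto
      then have "x = x' \<or> xor x x' = t"
        using assms x unfolding simon_promise_def by blast
      then show "x' \<in> {x, xor x t}"
        using xor_eq_iff[OF x x'(1) t] by blast
    next
      fix x' assume x': "x' \<in> {x, xor x t}"
      then have "x' \<in> ?C" using x t by auto
      moreover have "f x' = f x"
      proof (cases "x' = x")
        case False
        then have "xor x x' = t" using x x' t by simp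
        moreover have "\<forall>y\<in>?C. x \<noteq> y \<longrightarrow> (f x = f y \<longleftrightarrow> xor x y = t)"
          using assms x unfolding simon_promise_def by blast
        ultimately show ?thesis
          using \<open>x' \<in> ?C\<close> False by metis
      qed simp
      ultimately show "x' \<in> {x'\<in>?C. f x' = f x}" by simp
    qed
    have "(\<Sum>x'\<in>?C. sgn_dot x z * sgn_dot x' z / 4 ^ n * of_bool (f x' = f x)) =
        (\<Sum>x'\<in>{x'\<in>?C. f x' = f x}. sgn_dot x z * sgn_dot x' z / 4 ^ n)"
      by (subst sum.inter_filter) (auto intro!: sum.cong)
    also have "\<dots> = (if t = replicate n False then 1 else 1 + sgn_dot t z) / 4 ^ n"
    proof (cases "t = replicate n False")
      case True
      then have "xor x t = x" using x t by (simp add: xor_eq_self_iff)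
      then show ?thesis unfolding eq using True by simp
    next
      case False
      then have "xor x t \<noteq> x" using x t by (simp add: xor_eq_self_iff)
      then show ?thesis unfolding eq using False x t
        by (simp add: sgn_dot_xor mult.assoc[symmetric] add_divide_distrib)
    qed
    finally show "(\<Sum>x'\<in>?C. sgn_dot x z * sgn_dot x' z / 4 ^ n * of_bool (f x' = f x)) =
        (if t = replicate n False then 1 else 1 + sgn_dot t z) / 4 ^ n" .
  qed
  also have "\<dots> = 2 ^ n * ((if t = replicate n False then 1 else 1 + sgn_dot t z) / 4 ^ n)"
    by (simp add: card_cube)
  also have "(4 :: complex) ^ n = 2 ^ n * 2 ^ n"
    by (simp flip: power_mult_distrib)
  finally show ?thesis by simp
qed

lemma simon_output_uniform:
  assumes "simon_promise n f t" "x \<in> cube n"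
  shows "simon_output n f x = pmf (pmf_of_set {x \<in> cube n. dot x t = 0}) x"
proof -
  have t: "t \<in> cube n" using assms by (simp add: simon_promise_def)
  let ?S = "{x \<in> cube n. dot x t = 0}"
  have fin: "finite ?S" by simp
  have "(\<Sum>i<n. of_bool (replicate n False ! i) * of_bool (t ! i)) = (0 :: nat)"
    by (intro sum.neutral) simp
  then have "replicate n False \<in> ?S" by (simp only: mem_Collect_eq cube_def dot_def length_replicate mod_0 simp_thms)
  then have ne: "?S \<noteq> {}" by blast
  have "complex_of_nat (card ?S) = (\<Sum>x\<in>cube n. (1 + sgn_dot x t) / 2)"
  proof -
    have "(\<Sum>x\<in>cube n. (1 + sgn_dot x t) / 2) = (\<Sum>x\<in>cube n. if dot x t = 0 then 1 else 0)"
      by (intro sum.cong) (auto simp: sgn_dot_eq)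
    also have "\<dots> = (\<Sum>x\<in>?S. 1)" by (subst sum.inter_filter) auto
    finally show ?thesis by simp
  qed
  also have "\<dots> = (2 ^ n + (\<Sum>x\<in>cube n. sgn_dot x t)) / 2"
    by (simp add: sum_divide_distrib[symmetric] sum.distrib card_cube)
  finally have card: "complex_of_nat (card ?S) = (if t = replicate n False then 2 ^ n else 2 ^ n / 2)"
    using sum_sgn_dot[OF t] by auto
  have "complex_of_real (real (card ?S)) =
      complex_of_real (if t = replicate n False then 2 ^ n else 2 ^ n / 2)"
    unfolding of_real_of_nat_eq card by simp
  then have card': "real (card ?S) = (if t = replicate n False then 2 ^ n else 2 ^ n / 2)"
    unfolding of_real_eq_iff .
  have "simon_density n f x x = complex_of_real (if t = replicate n False then 1 / 2 ^ n
      else (if dot x t = 0 then 2 else 0) / 2 ^ n)"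
    unfolding simon_density_diag[OF assms(1)] sgn_dot_eq dot_commute[OF t assms(2)] by simp
  then have "simon_output n f x = (if t = replicate n False then 1 / 2 ^ n
      else (if dot x t = 0 then 2 else 0) / 2 ^ n)"
    by (simp add: simon_output_def measure_prob_def)
  moreover have "dot x t = 0" if "t = replicate n False"
  proof -
    have "(\<Sum>i<n. of_bool (x ! i) * of_bool (t ! i)) = (0 :: nat)"
      using that by (intro sum.neutral) simp
    then show ?thesis
      using assms(2) by (simp only: dot_def cube_def mem_Collect_eq mod_0)
  qed
  ultimately show ?thesis
    using assms(2) by (auto simp: pmf_of_set[OF ne fin] card' indicator_def)
qed

lemma depolarise_diag:
  assumes "z \<in> cube n" "i < n"
  shows "depolarise \<epsilon> i \<rho> z z =
    of_real (1 - \<epsilon> / 2) * \<rho> z z + of_real (\<epsilon> / 2) * \<rho> (z[i := \<not> z ! i]) (z[i := \<not> z ! i])"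
proof -
  have "z[i := z ! i] = z" by simp
  then have "(\<Sum>b\<in>UNIV. \<rho> (z[i := b]) (z[i := b])) = \<rho> z z + \<rho> (z[i := \<not> z ! i]) (z[i := \<not> z ! i])"
    by (cases "z ! i") (simp_all add: UNIV_bool add.commute)
  then show ?thesis
    by (simp add: depolarise_def algebra_simps)
qed

lemma fold_depolarise_diag:
  assumes "k \<le> n" "z \<in> cube n"
  shows "fold (depolarise \<epsilon>) [0..<k] \<rho> z z =
    (\<Sum>y | y \<in> cube n \<and> (\<forall>i\<in>{k..<n}. y ! i = z ! i).
       \<rho> y y * of_real (\<Prod>i<k. if y ! i = z ! i then 1 - \<epsilon> / 2 else \<epsilon> / 2))"
  using assms
proof (induction k arbitrary: z)
  case 0
  then have "{y. y \<in> cube n \<and> (\<forall>i\<in>{0..<n}. y ! i = z ! i)} = {z}"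
    by (auto simp: cube_def intro: nth_equalityI)
  then show ?case by simp
next
  case (Suc k)
  define S where "S j u = {y. y \<in> cube n \<and> (\<forall>i\<in>{j..<n}. y ! i = u ! i)}" for j and u :: "bool list"
  define w where "w = z[k := \<not> z ! k]"
  let ?P = "\<lambda>k u y. of_real (\<Prod>i<k. if y ! i = u ! i then 1 - \<epsilon> / 2 else \<epsilon> / 2) :: complex"
  have w: "w \<in> cube n" and z: "z \<in> cube n" and k: "k < n"
    using Suc.prems by (auto simp: w_def cube_def)
  have wk: "w ! k \<longleftrightarrow> \<not> z ! k" and wi: "i \<noteq> k \<Longrightarrow> w ! i = z ! i" for i
    using z k by (auto simp: w_def cube_def)
  have fin: "finite (S j u)" for j u
    by (rule finite_subset[OF _ finite_cube[of n]]) (auto simp: S_def)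
  have split: "S (Suc k) z = S k z \<union> S k w"
  proof (intro set_eqI iffI)
    fix y assume y: "y \<in> S (Suc k) z"
    show "y \<in> S k z \<union> S k w"
    proof (cases "y ! k = z ! k")
      case True
      have "y ! i = z ! i" if "i \<in> {k..<n}" for i
        using that True y unfolding S_def by (cases "i = k") auto
      then show ?thesis using y by (simp add: S_def)
    next
      case False
      have "y ! i = w ! i" if "i \<in> {k..<n}" for i
        using that False wk wi[of i] y unfolding S_def by (cases "i = k") auto
      then show ?thesis using y by (simp add: S_def)
    qed
  next
    fix y assume "y \<in> S k z \<union> S k w"
    then show "y \<in> S (Suc k) z" using wi unfolding S_def by auto
  qed
  have disj: "S k z \<inter> S k w = {}"
  proof -
    have False if "y \<in> S k z" "y \<in> S k w" for y
    proof -
      have "y ! k = z ! k" "y ! k = w ! k"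
        using that k unfolding S_def by auto
      then show False using wk by simp
    qed
    then show ?thesis by blast
  qed
  have "fold (depolarise \<epsilon>) [0..<Suc k] \<rho> z z = depolarise \<epsilon> k (fold (depolarise \<epsilon>) [0..<k] \<rho>) z z"
    by simp
  also have "\<dots> = of_real (1 - \<epsilon> / 2) * (\<Sum>y\<in>S k z. \<rho> y y * ?P k z y)
      + of_real (\<epsilon> / 2) * (\<Sum>y\<in>S k w. \<rho> y y * ?P k w y)"
    unfolding depolarise_diag[OF z k] w_def[symmetric]
    using Suc.IH[OF _ z] Suc.IH[OF _ w] k by (simp add: S_def)
  also have "of_real (1 - \<epsilon> / 2) * (\<Sum>y\<in>S k z. \<rho> y y * ?P k z y) = (\<Sum>y\<in>S k z. \<rho> y y * ?P (Suc k) z y)"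
    unfolding sum_distrib_left using k by (intro sum.cong) (auto simp: S_def)
  also have "of_real (\<epsilon> / 2) * (\<Sum>y\<in>S k w. \<rho> y y * ?P k w y) = (\<Sum>y\<in>S k w. \<rho> y y * ?P (Suc k) z y)"
    unfolding sum_distrib_left
  proof (intro sum.cong refl)
    fix y assume "y \<in> S k w"
    then have "y ! k = w ! k" using k by (auto simp: S_def)
    moreover have "?P k w y = ?P k z y"
      by (intro arg_cong[where f = of_real] prod.cong) (auto simp: wi)
    ultimately show "of_real (\<epsilon> / 2) * (\<rho> y y * ?P k w y) = \<rho> y y * ?P (Suc k) z y"
      using wk by simp
  qed
  also have "(\<Sum>y\<in>S k z. \<rho> y y * ?P (Suc k) z y) + (\<Sum>y\<in>S k w. \<rho> y y * ?P (Suc k) z y) =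
      (\<Sum>y\<in>S (Suc k) z. \<rho> y y * ?P (Suc k) z y)"
    unfolding split by (rule sum.union_disjoint[symmetric]) (use fin disj in auto)
  finally show ?case by (simp only: S_def)
qed

text \<open>The noise is the same as flipping each output bit independently with probability \<open>\<epsilon>/2\<close>.\<close>

lemma noisy_simon_output_bit_flips:
  assumes "x \<in> cube n"
  shows "noisy_simon_output \<epsilon> n f x =
    (\<Sum>y\<in>cube n. simon_output n f y * (\<Prod>i<n. if y ! i = x ! i then 1 - \<epsilon> / 2 else \<epsilon> / 2))"
proof -
  have "{y. y \<in> cube n \<and> (\<forall>i\<in>{n..<n}. y ! i = x ! i)} = cube n"
    by simp
  then have "depolarise_all \<epsilon> n (simon_density n f) x x = (\<Sum>y\<in>cube n. simon_density n f y y *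
      of_real (\<Prod>i<n. if y ! i = x ! i then 1 - \<epsilon> / 2 else \<epsilon> / 2))"
    unfolding depolarise_all_def fold_depolarise_diag[OF order.refl assms] by (simp only:)
  moreover have "Re (c * of_real r) = Re c * r" for c r
    by simp
  ultimately show ?thesis
    by (simp only: noisy_simon_output_def simon_output_def measure_prob_def Re_sum)
qed

lemma run_halted:
  assumes "halts_within n f c T" "T \<le> T'"
  shows "run n f c T' = run n f c T"
  using assms(2)
proof (induction T' rule: dec_induct)
  case (step m)
  have "run n f c (Suc m) = bind_pmf (run n f c T) (\<lambda>(c', s'). Defs.step n f c' s')"
    using step.IH by simp
  also have "\<dots> = bind_pmf (run n f c T) return_pmf"
    using assms(1) by (intro bind_pmf_cong) (auto simp: halts_within_def)
  finally show ?case by (simp add: bind_return_pmf')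
qed simp

end

theory Submission
  imports Defs
begin

text \<open>
  On the Fourier side the noiseless distribution is \<open>2\<^sup>-\<^sup>n (1 + (-1)\<^bsup>x\<cdot>t\<^esup>)\<close> for \<open>t \<noteq> 0\<close>, and the noise damps
  the coefficient of \<open>t\<close> by \<open>(1 - \<epsilon>)\<^bsup>|t|\<^esup>\<close>.  If \<open>|t|\<close> exceeds a constant \<open>c\<close> with \<open>(1 - \<epsilon>)\<^sup>c \<le> \<delta>\<close>, the
  uniform distribution is close enough.  Otherwise \<open>t\<close> is found by querying all \<open>O(n\<^sup>c)\<close> strings of
  weight at most \<open>c\<close> and comparing the answers with \<open>f 0\<close>.  A uniform \<open>x\<close> in which, whenever
  \<open>x \<cdot> t = 1\<close>, one bit of the support of \<open>t\<close> is flipped with probability \<open>\<lambda>\<close> has distribution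
  \<open>2\<^sup>-\<^sup>n (1 + \<lambda> (-1)\<^bsup>x\<cdot>t\<^esup>)\<close>; a dyadic approximation \<open>\<lambda>\<close> of \<open>(1 - \<epsilon>)\<^bsup>|t|\<^esup>\<close> can be realised with coins.
\<close>

section \<open>Executing programs\<close>

text \<open>\<open>run\<close> appends steps at the end and starts from \<open>init_state n\<close>.
  Composing programs calls for peeling off the first step from an arbitrary configuration.\<close>

primrec steps :: "nat \<Rightarrow> (bool list \<Rightarrow> 'y) \<Rightarrow> nat \<Rightarrow> program \<times> 'y state \<Rightarrow> (program \<times> 'y state) pmf" where
  "steps n f 0 cs = return_pmf cs"
| "steps n f (Suc T) cs = bind_pmf (step n f (fst cs) (snd cs)) (steps n f T)"

lemma steps_add: "steps n f (T + T') cs = bind_pmf (steps n f T cs) (steps n f T')"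
proof (induction T arbitrary: cs)
  case (Suc T)
  have "steps n f (T + T') = (\<lambda>cs. bind_pmf (steps n f T cs) (steps n f T'))"
    using Suc by blast
  then show ?case by (simp add: bind_assoc_pmf)
qed (simp add: bind_return_pmf)

lemma steps_0: "steps n f 0 = return_pmf"
  by (rule ext) simp

lemma run_eq_steps: "run n f c T = steps n f T (c, init_state n)"
proof (induction T)
  case (Suc T)
  have "steps n f (Suc 0) = (\<lambda>(c', s'). step n f c' s')"
    by (auto simp: fun_eq_iff bind_return_pmf' steps_0)
  then show ?case
    using steps_add[of n f T "Suc 0" "(c, init_state n)"] Suc by simp
qed simp

lemma steps_Skip [simp]: "steps n f T (Skip, s) = return_pmf (Skip, s)"
  by (induction T) (auto simp: bind_return_pmf)

text \<open>Total correctness with a time bound: \<open>D\<close> is the distribution of the final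
  state. Halted configurations stay put, so \<open>T\<close> is only an upper bound and costs may be
  rounded up.\<close>

definition yields ::
    "nat \<Rightarrow> (bool list \<Rightarrow> 'y) \<Rightarrow> program \<Rightarrow> 'y state \<Rightarrow> nat \<Rightarrow> 'y state pmf \<Rightarrow> bool" where
  "yields n f c s T D \<longleftrightarrow> steps n f T (c, s) = map_pmf (Pair Skip) D"

lemma yields_mono:
  assumes "yields n f c s T D" "T \<le> T'"
  shows "yields n f c s T' D"
  using assms steps_add[of n f T "T' - T" "(c, s)"]
  by (simp add: yields_def bind_map_pmf map_pmf_def[symmetric] o_def)

lemma yields_Skip_iff [simp]: "yields n f Skip s T D \<longleftrightarrow> D = return_pmf s"
proof
  assume "yields n f Skip s T D"
  then have "map_pmf snd (map_pmf (Pair Skip) D) = map_pmf snd (return_pmf (Skip, s))"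
    by (simp add: yields_def)
  then show "D = return_pmf s" by (simp add: pmf.map_comp o_def)
qed (simp add: yields_def)

lemma yields_step:
  assumes "step n f c s = map_pmf g M"
    and "\<And>x. x \<in> set_pmf M \<Longrightarrow> yields n f (fst (g x)) (snd (g x)) T (D x)"
  shows "yields n f c s (Suc T) (bind_pmf M D)"
  using assms unfolding yields_def
  by (auto simp: bind_map_pmf map_bind_pmf intro!: bind_pmf_cong)

lemma yields_step1:
  assumes "step n f c s = return_pmf (c', s')" "yields n f c' s' T D"
  shows "yields n f c s (Suc T) D"
  using assms by (simp add: yields_def bind_return_pmf)

text \<open>Induction on \<open>T\<close>, lifting the first step of \<open>c\<close> through
  \<open>Seq\<close>. The extra unit of time pays for the step from \<open>Seq Skip d\<close> to
  \<open>d\<close>.\<close>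

lemma yields_Seq:
  assumes "yields n f c s T D" "\<And>s'. s' \<in> set_pmf D \<Longrightarrow> yields n f d s' T' (E s')"
  shows "yields n f (Seq c d) s (T + T' + 1) (bind_pmf D E)"
  using assms
proof (induction T arbitrary: c s D)
  case 0
  have "set_pmf (return_pmf (c, s)) = set_pmf (map_pmf (Pair Skip) D)"
    using 0(1) by (simp add: yields_def)
  then have "c = Skip" by (auto simp: image_def dest: equalityD1)
  then show ?case
    using 0 by (auto simp: bind_return_pmf intro!: yields_step1[of _ _ _ _ d s])
next
  case (Suc T)
  show ?case
  proof (cases "c = Skip")
    case True
    then have D: "D = return_pmf s" using Suc.prems by simp
    have "yields n f (Seq c d) s (Suc T') (E s)"
      using Suc.prems D True by (intro yields_step1[of _ _ _ _ d s]) auto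
    then show ?thesis
      unfolding D bind_return_pmf by (rule yields_mono) simp
  next
    case False
    \<comment> \<open>\<open>D'\<close> gives the final states reached from each successor
      \<open>cs\<close>. \<open>D\<close> is their mixture, and since the mixture has halted, so has
      each component.\<close>
    define D' where "D' cs = map_pmf snd (steps n f T cs)" for cs
    have eq: "bind_pmf (step n f c s) (steps n f T) = map_pmf (Pair Skip) D"
      using Suc.prems(1) by (simp add: yields_def)
    have D: "D = bind_pmf (step n f c s) D'"
    proof -
      have "D = map_pmf snd (map_pmf (Pair Skip) D)" by (simp add: pmf.map_comp o_def)
      then show ?thesis unfolding eq[symmetric] D'_def by (simp add: map_bind_pmf)
    qed
    have Y: "yields n f (fst cs) (snd cs) T (D' cs)" if "cs \<in> set_pmf (step n f c s)" for cs
    proof -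
      have "set_pmf (steps n f T cs) \<subseteq> set_pmf (map_pmf (Pair Skip) D)"
        unfolding eq[symmetric] using that by auto
      then have "fst y = Skip" if "y \<in> set_pmf (steps n f T cs)" for y
        using that by auto
      then have "steps n f T cs = map_pmf (\<lambda>y. (Skip, snd y)) (steps n f T cs)"
        by (intro pmf.map_ident_strong[symmetric]) (auto simp: prod_eq_iff)
      then show ?thesis by (simp add: yields_def D'_def pmf.map_comp o_def)
    qed
    have "yields n f (Seq c d) s (Suc (T + T' + 1)) (bind_pmf (step n f c s) (\<lambda>cs. bind_pmf (D' cs) E))"
    proof (rule yields_step)
      show "step n f (Seq c d) s = map_pmf (\<lambda>(c', s'). (Seq c' d, s')) (step n f c s)"
        using False by simp
      fix cs assume cs: "cs \<in> set_pmf (step n f c s)"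
      have "yields n f (Seq (fst cs) d) (snd cs) (T + T' + 1) (bind_pmf (D' cs) E)"
        by (rule Suc.IH[OF Y[OF cs]]) (use Suc.prems(2) cs in \<open>auto simp: D\<close>)
      then show "yields n f (fst (case cs of (c', s') \<Rightarrow> (Seq c' d, s')))
          (snd (case cs of (c', s') \<Rightarrow> (Seq c' d, s'))) (T + T' + 1) (bind_pmf (D' cs) E)"
        by (simp add: case_prod_beta)
    qed
    then show ?thesis by (simp add: D bind_assoc_pmf)
  qed
qed

lemma yields_Seq1:
  assumes "yields n f c s T (return_pmf s')" "yields n f d s' T' D"
  shows "yields n f (Seq c d) s (T + T' + 1) D"
  using yields_Seq[OF assms(1), of d T' "\<lambda>_. D"] assms(2) by (simp add: bind_return_pmf)

text \<open>\<open>I k\<close> is an invariant for states with \<open>k\<close> iterations left.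
  Besides its body, each iteration pays 2, for unfolding the loop and for discharging
  \<open>Seq\<close>; the final 1 pays for the exit.\<close>

lemma yields_while:
  assumes "\<And>k s. I (Suc k) s \<Longrightarrow> reg s r \<noteq> 0 \<and> (\<exists>s'. yields n f c s T (return_pmf s') \<and> I k s')"
    and "\<And>s. I 0 s \<Longrightarrow> reg s r = 0"
    and "I k s"
  shows "\<exists>s'. yields n f (WhileNZ r c) s (k * (T + 2) + 1) (return_pmf s') \<and> I 0 s'"
  using assms(3)
proof (induction k arbitrary: s)
  case 0
  then show ?case using assms(2)[of s] by (auto intro!: exI[of _ s] yields_step1)
next
  case (Suc k)
  obtain s1 where s1: "reg s r \<noteq> 0" "yields n f c s T (return_pmf s1)" "I k s1"
    using assms(1)[OF Suc.prems] by blast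
  obtain s2 where s2: "yields n f (WhileNZ r c) s1 (k * (T + 2) + 1) (return_pmf s2)" "I 0 s2"
    using Suc.IH[OF s1(3)] by blast
  have "yields n f (WhileNZ r c) s (Suc (T + (k * (T + 2) + 1) + 1)) (return_pmf s2)"
    using s1(1) by (intro yields_step1[OF _ yields_Seq1[OF s1(2) s2(1)]]) simp
  then have "yields n f (WhileNZ r c) s (Suc k * (T + 2) + 1) (return_pmf s2)"
    by (rule yields_mono) simp
  then show ?case using s2(2) by blast
qed

section \<open>Programs without coins and loops, executed by a function\<close>

primrec straight :: "program \<Rightarrow> bool" where
  "straight Skip \<longleftrightarrow> True"
| "straight (Const r k) \<longleftrightarrow> True"
| "straight (Add r a b) \<longleftrightarrow> True"
| "straight (Sub r a b) \<longleftrightarrow> True"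
| "straight (Load r a) \<longleftrightarrow> True"
| "straight (Store a r) \<longleftrightarrow> True"
| "straight (Coin r) \<longleftrightarrow> False"
| "straight (Query a r) \<longleftrightarrow> True"
| "straight (EqAns r a b) \<longleftrightarrow> True"
| "straight (Seq c d) \<longleftrightarrow> straight c \<and> straight d"
| "straight (IfNZ r c d) \<longleftrightarrow> straight c \<and> straight d"
| "straight (WhileNZ r c) \<longleftrightarrow> False"

text \<open>On programs that are not \<^const>\<open>straight\<close>, the next two functions return junk.\<close>

primrec ev :: "nat \<Rightarrow> (bool list \<Rightarrow> 'y) \<Rightarrow> program \<Rightarrow> 'y state \<Rightarrow> 'y state" where
  "ev n f Skip s = s"
| "ev n f (Const r k) s = set_reg r k s"
| "ev n f (Add r a b) s = set_reg r (reg s a + reg s b) s"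
| "ev n f (Sub r a b) s = set_reg r (reg s a - reg s b) s"
| "ev n f (Load r a) s = set_reg r (mem s (reg s a)) s"
| "ev n f (Store a r) s = s\<lparr>mem := (mem s)(reg s a := reg s r)\<rparr>"
| "ev n f (Coin r) s = s"
| "ev n f (Query a r) s = s\<lparr>ans := (ans s)(a := Some (f (read_bits n (reg s r) s)))\<rparr>"
| "ev n f (EqAns r a b) s = set_reg r (of_bool (ans s a = ans s b)) s"
| "ev n f (Seq c d) s = ev n f d (ev n f c s)"
| "ev n f (IfNZ r c d) s = (if reg s r \<noteq> 0 then ev n f c s else ev n f d s)"
| "ev n f (WhileNZ r c) s = s"

primrec tm :: "program \<Rightarrow> nat" where
  "tm Skip = 0"
| "tm (Const r k) = 1"
| "tm (Add r a b) = 1"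
| "tm (Sub r a b) = 1"
| "tm (Load r a) = 1"
| "tm (Store a r) = 1"
| "tm (Coin r) = 1"
| "tm (Query a r) = 1"
| "tm (EqAns r a b) = 1"
| "tm (Seq c d) = tm c + tm d + 1"
| "tm (IfNZ r c d) = Suc (tm c + tm d)"
| "tm (WhileNZ r c) = 0"

lemma yields_straight: "straight c \<Longrightarrow> yields n f c s (tm c) (return_pmf (ev n f c s))"
proof (induction c arbitrary: s)
  case (Seq c d)
  then show ?case by (auto intro: yields_Seq1[simplified])
next
  case (IfNZ r c d)
  then show ?case
    \<comment> \<open>\<open>tm\<close> adds up both branches, so each branch bound is relaxed to
      the sum.\<close>
    using yields_mono[OF IfNZ.IH(1)[of s], of "tm c + tm d"]
      yields_mono[OF IfNZ.IH(2)[of s], of "tm c + tm d"]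
    by (auto intro!: yields_step1)
qed (auto intro!: yields_step1)

lemma yields_straight_le:
  "straight c \<Longrightarrow> tm c \<le> T \<Longrightarrow> yields n f c s T (return_pmf (ev n f c s))"
  by (rule yields_mono[OF yields_straight])

primrec blk :: "program list \<Rightarrow> program" where
  "blk [] = Skip"
| "blk (c # cs) = Seq c (blk cs)"

lemma halts_within_if_yields:
  "yields n f c (init_state n) T D \<Longrightarrow> halts_within n f c T"
  by (auto simp: yields_def halts_within_def run_eq_steps)

lemma sampled_if_yields:
  "yields n f c (init_state n) T D \<Longrightarrow> sampled n f c T = map_pmf (read_bits n 0) D"
  by (simp add: yields_def sampled_def run_eq_steps pmf.map_comp o_def)

section \<open>The noisy output distribution\<close>

definition supp :: "bool list \<Rightarrow> nat set" where
  "supp t = {i. i < length t \<and> t ! i}"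

text \<open>The Fourier character \<open>(-1) ^ dot t x\<close> as a real number, phrased through
  the parity that the program keeps in a register.\<close>

definition sg :: "bool list \<Rightarrow> bool list \<Rightarrow> real" where
  "sg t x = (if even (card {i \<in> supp t. x ! i}) then 1 else -1)"

lemma finite_supp [simp]: "finite (supp t)"
  by (simp add: supp_def)

lemma supp_empty_iff: "t \<in> cube n \<Longrightarrow> supp t = {} \<longleftrightarrow> t = replicate n False"
  by (auto simp: supp_def cube_def list_eq_iff_nth_eq)

text \<open>Splitting off the last bit exchanges sum and product, so that Fourier coefficients of
  independent bit flips can be computed one coordinate at a time.\<close>

lemma sum_cube_prod:
  fixes h :: "nat \<Rightarrow> bool \<Rightarrow> real"
  shows "(\<Sum>y\<in>cube n. \<Prod>i<n. h i (y ! i)) = (\<Prod>i<n. h i True + h i False)"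
proof (induction n)
  case 0
  have "cube 0 = {[]}" by (auto simp: cube_def)
  then show ?case by simp
next
  case (Suc n)
  have snoc: "length y = Suc n \<Longrightarrow> butlast y @ [last y] = y" for y :: "bool list"
    by (intro append_butlast_last_id) auto
  have "(\<Sum>y\<in>cube (Suc n). \<Prod>i<Suc n. h i (y ! i)) =
      (\<Sum>(y, b)\<in>cube n \<times> UNIV. \<Prod>i<Suc n. h i ((y @ [b]) ! i))"
    by (rule sum.reindex_bij_witness[of _ "\<lambda>(y, b). y @ [b]" "\<lambda>y. (butlast y, last y)"])
      (auto simp: cube_def snoc)
  also have "\<dots> = (\<Sum>(y, b)\<in>cube n \<times> UNIV. (\<Prod>i<n. h i (y ! i)) * h n b)"
    by (intro sum.cong refl) (auto simp: cube_def nth_append intro!: prod.cong)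
  also have "\<dots> = (\<Sum>y\<in>cube n. \<Prod>i<n. h i (y ! i)) * (h n True + h n False)"
    by (simp add: sum.cartesian_product[symmetric] UNIV_bool sum_distrib_right distrib_left sum.distrib)
  finally show ?case using Suc by simp
qed

lemma sgn_dot_eq_sg:
  assumes "t \<in> cube n"
  shows "sgn_dot t x = complex_of_real (sg t x)"
proof -
  have "(\<Sum>i<n. of_bool (t ! i) * of_bool (x ! i)) = (\<Sum>i<n. of_bool (t ! i \<and> x ! i) :: nat)"
    by (intro sum.cong) auto
  also have "\<dots> = card {i \<in> supp t. x ! i}"
    using assms by (auto simp: cube_def supp_def Int_def intro!: arg_cong[of _ _ card])
  finally have "dot t x = card {i \<in> supp t. x ! i} mod 2"
    using assms by (simp add: dot_def cube_def)
  then show ?thesis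
    by (auto simp: sgn_dot_eq sg_def even_iff_mod_2_eq_zero)
qed

lemma sg_prod:
  assumes "t \<in> cube n"
  shows "sg t x = (\<Prod>i<n. if t ! i \<and> x ! i then -1 else 1)"
proof -
  have "complex_of_real (sg t x) = complex_of_real (\<Prod>i<n. if t ! i \<and> x ! i then -1 else 1)"
    unfolding sgn_dot_eq_sg[OF assms, symmetric] sgn_dot_prod of_real_prod
    using assms by (intro prod.cong) (auto simp: cube_def)
  then show ?thesis by (simp only: of_real_eq_iff)
qed

lemma simon_output_eq:
  assumes "simon_promise n f t"
  shows "simon_output n f z = (1 + of_bool (supp t \<noteq> {}) * sg t z) / 2 ^ n"
proof -
  have t: "t \<in> cube n" using assms by (simp add: simon_promise_def)
  have "simon_density n f z z = complex_of_real ((1 + of_bool (supp t \<noteq> {}) * sg t z) / 2 ^ n)"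
    unfolding simon_density_diag[OF assms] sgn_dot_eq_sg[OF t] supp_empty_iff[OF t] by simp
  then show ?thesis by (simp add: simon_output_def measure_prob_def)
qed

text \<open>Each noisy qubit damps the Fourier coefficient of \<open>t\<close> by \<open>1 - \<epsilon>\<close>.\<close>

lemma noisy_simon_output_eq:
  assumes "simon_promise n f t" "x \<in> cube n"
  shows "noisy_simon_output \<epsilon> n f x =
    (1 + of_bool (supp t \<noteq> {}) * (1 - \<epsilon>) ^ card (supp t) * sg t x) / 2 ^ n"
proof -
  have t: "t \<in> cube n" using assms by (simp add: simon_promise_def)
  let ?w = "\<lambda>y. \<Prod>i<n. if y ! i = x ! i then 1 - \<epsilon> / 2 else \<epsilon> / 2"
  have 1: "(\<Sum>y\<in>cube n. ?w y) = 1"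
    using sum_cube_prod[where n=n and h="\<lambda>i b. if b = x ! i then 1 - \<epsilon> / 2 else \<epsilon> / 2"]
    by (auto intro!: prod.neutral)
  have "(\<Sum>y\<in>cube n. sg t y * ?w y) =
      (\<Prod>i<n. (if t ! i then 1 - \<epsilon> else 1) * (if t ! i \<and> x ! i then -1 else 1))"
  proof -
    let ?h = "\<lambda>i b. (if t ! i \<and> b then -1 else 1) * (if b = x ! i then 1 - \<epsilon> / 2 else \<epsilon> / 2)"
    have "(\<Sum>y\<in>cube n. sg t y * ?w y) = (\<Sum>y\<in>cube n. \<Prod>i<n. ?h i (y ! i))"
      by (simp add: sg_prod[OF t] prod.distrib)
    also have "\<dots> = (\<Prod>i<n. ?h i True + ?h i False)"
      by (rule sum_cube_prod)
    \<comment> \<open>Where \<open>t ! i\<close> holds, the two weights enter with opposite signs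
      and leave \<open>1 - \<epsilon>\<close> times a sign; elsewhere they add up to 1.\<close>
    also have "\<dots> = (\<Prod>i<n. (if t ! i then 1 - \<epsilon> else 1) * (if t ! i \<and> x ! i then -1 else 1))"
      by (intro prod.cong) auto
    finally show ?thesis .
  qed
  also have "\<dots> = (\<Prod>i<n. if t ! i then 1 - \<epsilon> else 1) * sg t x"
    by (simp add: prod.distrib sg_prod[OF t])
  also have "(\<Prod>i<n. if t ! i then 1 - \<epsilon> else 1) = (1 - \<epsilon>) ^ card (supp t)"
  proof -
    have "supp t = {i \<in> {..<n}. t ! i}" using t by (auto simp: cube_def supp_def)
    then show ?thesis by (simp add: prod.inter_filter[symmetric])
  qed
  finally have 2: "(\<Sum>y\<in>cube n. sg t y * ?w y) = (1 - \<epsilon>) ^ card (supp t) * sg t x" .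
  have "noisy_simon_output \<epsilon> n f x =
      (\<Sum>y\<in>cube n. (?w y + of_bool (supp t \<noteq> {}) * (sg t y * ?w y)) / 2 ^ n)"
    unfolding noisy_simon_output_bit_flips[OF assms(2)] simon_output_eq[OF assms(1)]
    by (intro sum.cong refl) (simp add: algebra_simps)
  also have "\<dots> = ((\<Sum>y\<in>cube n. ?w y) + of_bool (supp t \<noteq> {}) * (\<Sum>y\<in>cube n. sg t y * ?w y)) / 2 ^ n"
    by (simp only: sum_divide_distrib[symmetric] sum.distrib sum_distrib_left)
  finally show ?thesis by (simp add: 1 2)
qed

section \<open>The classical sampler\<close>

text \<open>
  Registers: 0 holds \<open>n\<close>, 1 the constant 1, 2 a uniform number \<open>u\<close> below \<open>2 ^ K\<close>, 3 is the
  loop counter of \<open>fill\<close> and afterwards one plus the position to be flipped (0 for none), 4 and 5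
  are temporary.  The search chooses indices in decreasing order, so that each set is visited once.
  At depth \<open>d\<close>, register \<open>7 + 2 d\<close> holds the last index chosen and
  register \<open>6 + 2 d\<close> the parity of the output string on the chosen set.
  The output string is in memory cells \<open>0..<n\<close>, the query string in cells \<open>n..<2n\<close>.
\<close>

primrec gen :: "nat \<Rightarrow> program" where
  "gen 0 = Skip"
| "gen (Suc K) = Seq (gen K) (Seq (Coin 4) (blk [Add 2 2 2, Add 2 2 4]))"

definition fill :: program where
  "fill = WhileNZ 3 (Seq (Sub 3 3 1) (Seq (Coin 4) (Store 3 4)))"

text \<open>Register 0 holds \<open>n\<close> and thus doubles as the base address of the query
  string. Answer 0 is the reference value of \<open>f\<close> at the zero string.\<close>

definition probe :: "nat \<Rightarrow> program" where
  "probe d = blk [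
     Sub (9 + 2 * d) (9 + 2 * d) 1,
     Add 4 0 (9 + 2 * d),
     Store 4 1,
     Load 5 (9 + 2 * d),
     IfNZ 5 (Sub (8 + 2 * d) 1 (6 + 2 * d)) (Add (8 + 2 * d) (6 + 2 * d) 5),
     Query 1 0,
     EqAns 5 0 1]"

text \<open>Truncated subtraction leaves a nonzero value exactly when \<open>u < m (Suc d)\<close>;
  \<open>Suc d\<close> is the size of the set just queried.\<close>

definition mark :: "(nat \<Rightarrow> nat) \<Rightarrow> nat \<Rightarrow> program" where
  "mark m d = IfNZ 5
     (IfNZ (8 + 2 * d)
       (blk [Const 5 (m (Suc d)), Sub 5 5 2, IfNZ 5 (Add 3 (9 + 2 * d) 1) Skip])
       Skip)
     Skip"

definition visit :: "(nat \<Rightarrow> nat) \<Rightarrow> nat \<Rightarrow> program" where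
  "visit m d = Seq (probe d) (mark m d)"

definition leave :: "nat \<Rightarrow> program" where
  "leave d = blk [Add 4 0 (9 + 2 * d), Const 5 0, Store 4 5]"

text \<open>\<open>e\<close> is the number of indices that may still be added. The recursion is
  unrolled while the program is built, giving \<open>e\<close> nested loops and no need for a stack.
  Adding a zeroed register serves as a copy.\<close>

primrec search :: "(nat \<Rightarrow> nat) \<Rightarrow> nat \<Rightarrow> nat \<Rightarrow> program" where
  "search m 0 d = Skip"
| "search m (Suc e) d =
     Seq (blk [Const 5 0, Add (9 + 2 * d) (7 + 2 * d) 5])
       (WhileNZ (9 + 2 * d) (Seq (visit m d) (Seq (search m e (Suc d)) (leave d))))"

text \<open>Each nesting level multiplies by \<open>n\<close>, the largest number of iterations; the
  constants are generous.\<close>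

primrec cost :: "nat \<Rightarrow> nat poly" where
  "cost 0 = 0"
| "cost (Suc e) = [:100:] + [:0, 1:] * (cost e + [:100:])"

definition finish :: program where
  "finish = IfNZ 3 (blk [Sub 3 3 1, Load 5 3, Sub 5 1 5, Store 3 5]) Skip"

lemma tm_visit: "straight (visit m d)" "tm (visit m d) \<le> 40"
  and tm_leave: "straight (leave d)" "tm (leave d) \<le> 20"
  by (simp_all add: visit_def probe_def mark_def leave_def)

section \<open>Searching for the support of the hidden string\<close>

definition verdict :: "(nat \<Rightarrow> nat) \<Rightarrow> bool list \<Rightarrow> bool list \<Rightarrow> nat \<Rightarrow> nat" where
  "verdict m t x u =
     (if odd (card {i \<in> supp t. x ! i}) \<and> u < m (card (supp t)) then Suc (Min (supp t)) else 0)"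

text \<open>The invariant at a node of the search tree: \<open>S\<close> is the set chosen so far,
  and \<open>r\<close> bounds the indices still available, with \<open>r = n\<close> at the
  root.\<close>

definition at_node ::
    "nat \<Rightarrow> (bool list \<Rightarrow> 'y) \<Rightarrow> bool list \<Rightarrow> nat \<Rightarrow> nat \<Rightarrow> nat \<Rightarrow> nat set \<Rightarrow> 'y state \<Rightarrow> bool" where
  "at_node n f x u d r S s \<longleftrightarrow>
     reg s 0 = n \<and> reg s 1 = 1 \<and> reg s 2 = u \<and> reg s (7 + 2 * d) = r \<and>
     reg s (6 + 2 * d) = of_bool (odd (card {i \<in> S. x ! i})) \<and>
     ans s 0 = Some (f (replicate n False)) \<and>
     (\<forall>i<n. mem s i = of_bool (x ! i)) \<and> (\<forall>i<n. mem s (n + i) = of_bool (i \<in> S)) \<and>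
     S \<subseteq> {r..<n} \<and> card S = d \<and> r \<le> n"

text \<open>The frame condition for work below depth \<open>d\<close>: temporaries, register 3 and
  the registers of deeper levels may change.\<close>

definition preserves :: "nat \<Rightarrow> 'y state \<Rightarrow> 'y state \<Rightarrow> bool" where
  "preserves d s s' \<longleftrightarrow> ans s' 0 = ans s 0 \<and>
     (\<forall>r. r < 8 + 2 * d \<and> r \<noteq> 3 \<and> r \<noteq> 4 \<and> r \<noteq> 5 \<longrightarrow> reg s' r = reg s r)"

lemma preserves_refl: "preserves d s s"
  by (simp add: preserves_def)

lemma preserves_trans: "preserves d s s' \<Longrightarrow> preserves d s' s'' \<Longrightarrow> preserves d s s''"
  by (simp add: preserves_def)

lemma preserves_Suc: "preserves (Suc d) s s' \<Longrightarrow> preserves d s s'"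
  by (simp add: preserves_def)

lemma at_node_preserves:
  assumes "at_node n f x u d r S s" "preserves d s s'" "mem s' = mem s"
  shows "at_node n f x u d r S s'"
  using assms by (simp add: at_node_def preserves_def)

text \<open>The promise is applied to the indicator string of \<open>S\<close> and the zero string,
  whose xor is the indicator itself. \<open>S \<noteq> {}\<close> makes the two strings
  distinct.\<close>

lemma query_hit_iff:
  assumes "simon_promise n f t" "S \<subseteq> {..<n}" "S \<noteq> {}"
  shows "f (map (\<lambda>i. i \<in> S) [0..<n]) = f (replicate n False) \<longleftrightarrow> supp t = S"
proof -
  let ?y = "map (\<lambda>i. i \<in> S) [0..<n]"
  have y: "?y \<in> cube n" "replicate n False \<in> cube n" by (auto simp: cube_def)
  have supp: "supp ?y = S" using assms(2) by (auto simp: supp_def)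
  then have ne: "?y \<noteq> replicate n False"
    using assms(3) supp_empty_iff[OF y(1)] by auto
  have "f ?y = f (replicate n False) \<longleftrightarrow> xor ?y (replicate n False) = t"
    using assms(1) y ne unfolding simon_promise_def by blast
  also have "xor ?y (replicate n False) = ?y"
    by (auto simp: xor_def intro!: nth_equalityI)
  also have "?y = t \<longleftrightarrow> supp t = S"
  proof
    assume "supp t = S"
    moreover have "length t = n" using assms(1) by (simp add: simon_promise_def cube_def)
    ultimately show "?y = t" by (auto simp: supp_def intro!: nth_equalityI)
  qed (use supp in auto)
  finally show ?thesis .
qed

lemma visit_correct:
  fixes m :: "nat \<Rightarrow> nat"
  assumes "simon_promise n f t"
    and s: "at_node n f x u d r S s" and k: "reg s (9 + 2 * d) = Suc k" "k < r"
  defines "s' \<equiv> ev n f (visit m d) s"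
  shows "at_node n f x u (Suc d) k (insert k S) s'" "preserves d s s'"
    "mem s' = (mem s)(n + k := 1)"
    "reg s' 3 = (if supp t = insert k S \<and> verdict m t x u \<noteq> 0 then verdict m t x u else reg s 3)"
proof -
  have kS: "k \<notin> S" "finite S" "S \<subseteq> {k..<n}" "k < n" and d: "card S = d"
    using s k by (auto simp: at_node_def intro: finite_subset)
  have par: "{i \<in> insert k S. x ! i} = (if x ! k then insert k {i \<in> S. x ! i} else {i \<in> S. x ! i})"
    by auto
  have card: "card {i \<in> insert k S. x ! i} = of_bool (x ! k) + card {i \<in> S. x ! i}"
    unfolding par using kS by simp
  have bits: "read_bits n n s'' = map (\<lambda>i. i \<in> insert k S) [0..<n]"
    if "mem s'' = (mem s)(n + k := 1)" for s'' :: "'a state"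
    using s unfolding read_bits_def that by (auto simp: at_node_def)
  have hit: "f (replicate n False) = f (map (\<lambda>i. i \<in> insert k S) [0..<n]) \<longleftrightarrow> supp t = insert k S"
    unfolding eq_commute[of "f (replicate n False)"]
    by (rule query_hit_iff[OF assms(1)]) (use kS in auto)
  \<comment> \<open>Indices are chosen in decreasing order, so on a match the newest one is the
    minimum that \<open>verdict\<close> refers to.\<close>
  have min: "Min (insert k S) = k"
    using kS by (intro Min_eqI) auto
  have regs: "reg s 0 = n" "reg s 1 = 1" "reg s 2 = u" "reg s (7 + 2 * d) = r"
    "reg s (6 + 2 * d) = of_bool (odd (card {i \<in> S. x ! i}))"
    "ans s 0 = Some (f (replicate n False))" "mem s k = of_bool (x ! k)"
    using s kS by (auto simp: at_node_def)
  define s1 where "s1 = ev n f (probe d) s"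
  have mem1: "mem s1 = (mem s)(n + k := 1)"
    using regs k kS by (simp add: s1_def probe_def set_reg_def)
  have p1: "preserves d s s1" "reg s1 3 = reg s 3"
    using regs k kS by (simp_all add: s1_def probe_def set_reg_def preserves_def)
  have r1: "reg s1 (9 + 2 * d) = k"
    using regs k kS by (simp add: s1_def probe_def set_reg_def)
  have r2: "reg s1 (8 + 2 * d) = of_bool (odd (card {i \<in> insert k S. x ! i}))"
    unfolding card using regs k kS
    by (cases "x ! k"; cases "odd (card {i \<in> S. x ! i})") (simp_all add: s1_def probe_def set_reg_def)
  have r3: "reg s1 5 = of_bool (supp t = insert k S)"
    unfolding hit[symmetric] using regs k kS
    by (simp add: s1_def probe_def set_reg_def bits del: insert_iff)
  have s': "s' = ev n f (mark m d) s1"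
    by (simp add: s'_def visit_def s1_def)
  have m': "mem s' = mem s1" "preserves d s1 s'" "reg s' (9 + 2 * d) = k"
    "reg s' (8 + 2 * d) = reg s1 (8 + 2 * d)"
    using r1 by (simp_all add: s' mark_def set_reg_def preserves_def)
  show "mem s' = (mem s)(n + k := 1)"
    using mem1 m' by simp
  show p': "preserves d s s'"
    using p1 m' preserves_trans by blast
  have "reg s1 1 = 1" "reg s1 2 = u"
    using p1 regs by (simp_all add: preserves_def)
  then show "reg s' 3 = (if supp t = insert k S \<and> verdict m t x u \<noteq> 0 then verdict m t x u else reg s 3)"
    using r1 r2 r3 p1 kS d
    by (cases "supp t = insert k S"; cases "odd (card {i \<in> insert k S. x ! i})"; cases "u < m (Suc d)")
      (simp_all add: s' mark_def set_reg_def verdict_def min)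
  show "at_node n f x u (Suc d) k (insert k S) s'"
    unfolding at_node_def
  proof (intro conjI)
    show "\<forall>i<n. mem s' i = of_bool (x ! i)" "\<forall>i<n. mem s' (n + i) = of_bool (i \<in> insert k S)"
      using s unfolding m' mem1 by (auto simp: at_node_def)
  qed (use p' regs m' r2 kS d in \<open>auto simp: preserves_def\<close>)
qed

text \<open>Induction on the remaining depth: the missing indices of the support are picked in
  decreasing order, the largest by the loop at this level. The assumption on register 3 handles a
  verdict of 0: a match then writes nothing, so the register must already be 0.\<close>

lemma search_correct:
  assumes "simon_promise n f t" "at_node n f x u d r S s"
    and "reg s 3 = 0 \<or> reg s 3 = verdict m t x u"
  shows "\<exists>s'. yields n f (search m e d) s (poly (cost e) n) (return_pmf s') \<and>
    preserves d s s' \<and> mem s' = mem s \<and>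
    (reg s' 3 = reg s 3 \<or> reg s' 3 = verdict m t x u) \<and>
    (S \<subset> supp t \<and> supp t - S \<subseteq> {..<r} \<and> card (supp t - S) \<le> e \<longrightarrow> reg s' 3 = verdict m t x u)"
  using assms(2,3)
proof (induction e arbitrary: d r S s)
  case 0
  have "card (supp t - S) \<noteq> 0" if "S \<subset> supp t" using that by auto
  then show ?case using preserves_refl by (intro exI[of _ s]) auto
next
  case (Suc e)
  let ?v = "verdict m t x u"
  let ?body = "Seq (visit m d) (Seq (search m e (Suc d)) (leave d))"
  let ?s0 = "ev n f (blk [Const 5 0, Add (9 + 2 * d) (7 + 2 * d) 5]) s"
  \<comment> \<open>\<open>k\<close> is both the loop counter and the number of iterations left. The
    last clause says that the verdict is settled once some missing index is at least
    \<open>k\<close>, because the largest missing one has then been tried.\<close>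
  define I where "I k s' \<longleftrightarrow> preserves d s s' \<and> mem s' = mem s \<and> reg s' (9 + 2 * d) = k \<and> k \<le> r \<and>
    (reg s' 3 = reg s 3 \<or> reg s' 3 = ?v) \<and>
    (S \<subset> supp t \<and> supp t - S \<subseteq> {..<r} \<and> card (supp t - S) \<le> Suc e \<and> \<not> supp t - S \<subseteq> {..<k}
       \<longrightarrow> reg s' 3 = ?v)" for k s'
  note node = Suc.prems(1)
  have rn: "r \<le> n" using node by (simp add: at_node_def)
  have init: "yields n f (blk [Const 5 0, Add (9 + 2 * d) (7 + 2 * d) 5]) s 20 (return_pmf ?s0)"
    by (rule yields_straight_le) auto
  have "I r ?s0"
    using node by (auto simp: I_def preserves_def set_reg_def at_node_def)
  moreover have "reg s' (9 + 2 * d) \<noteq> 0 \<and>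
      (\<exists>s''. yields n f ?body s' (poly (cost e) n + 62) (return_pmf s'') \<and> I k s'')"
    if I: "I (Suc k) s'" for k s'
  proof -
    let ?s1 = "ev n f (visit m d) s'"
    have n': "at_node n f x u d r S s'" and k: "reg s' (9 + 2 * d) = Suc k" "k < r"
      using I at_node_preserves[OF node] by (auto simp: I_def)
    note v = visit_correct[OF assms(1) n' k, where m = m]
    have "reg s' 3 = 0 \<or> reg s' 3 = ?v"
      using I Suc.prems(2) by (auto simp: I_def)
    then have F1: "reg ?s1 3 = 0 \<or> reg ?s1 3 = ?v" "reg ?s1 3 = reg s' 3 \<or> reg ?s1 3 = ?v"
      "supp t = insert k S \<Longrightarrow> reg ?s1 3 = ?v"
      using v(4) by auto
    obtain s2 where s2: "yields n f (search m e (Suc d)) ?s1 (poly (cost e) n) (return_pmf s2)"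
      "preserves (Suc d) ?s1 s2" "mem s2 = mem ?s1"
      "reg s2 3 = reg ?s1 3 \<or> reg s2 3 = ?v"
      "insert k S \<subset> supp t \<and> supp t - insert k S \<subseteq> {..<k} \<and> card (supp t - insert k S) \<le> e
        \<longrightarrow> reg s2 3 = ?v"
      using Suc.IH[OF v(1) F1(1)] by blast
    let ?s3 = "ev n f (leave d) s2"
    have "yields n f ?body s' (40 + (poly (cost e) n + 20 + 1) + 1) (return_pmf ?s3)"
      by (intro yields_Seq1[OF yields_straight_le yields_Seq1[OF s2(1) yields_straight_le]]
          tm_visit tm_leave)
    then have "yields n f ?body s' (poly (cost e) n + 62) (return_pmf ?s3)"
      by (rule yields_mono) simp
    moreover have "I k ?s3"
    proof -
      have r2: "reg s2 0 = n" "reg s2 (9 + 2 * d) = k"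
        using s2(2) v(1) by (auto simp: preserves_def at_node_def)
      \<comment> \<open>As \<open>k\<close> is not in \<open>S\<close>, cell \<open>n + k\<close>
        was 0 before the visit, so clearing it restores the memory.\<close>
      have kS: "k \<notin> S" "k < n" using n' k by (auto simp: at_node_def)
      then have "mem s' (n + k) = 0" using n' by (auto simp: at_node_def)
      then have "(mem s2)(n + k := 0) = mem s'"
        using s2(3) v(3) by auto
      then have mem: "mem ?s3 = mem s"
        using r2 I by (simp add: leave_def set_reg_def I_def)
      have "preserves d s2 ?s3" "reg ?s3 (9 + 2 * d) = k" and F3: "reg ?s3 3 = reg s2 3"
        using r2 by (simp_all add: leave_def set_reg_def preserves_def)
      then have p: "preserves d s ?s3" "reg ?s3 (9 + 2 * d) = k"
        using I v(2) preserves_Suc[OF s2(2)] preserves_trans unfolding I_def by blast+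
      have "reg s2 3 = ?v" if "S \<subset> supp t" "supp t - S \<subseteq> {..<r}" "card (supp t - S) \<le> Suc e"
        "\<not> supp t - S \<subseteq> {..<k}"
      \<comment> \<open>Either some missing index exceeds \<open>k\<close> and an earlier iteration
        settled the verdict, or \<open>k\<close> is the largest missing index. In the latter case
        this visit completes the support or the recursive search does.\<close>
      proof (cases "supp t - S \<subseteq> {..<Suc k}")
        case False
        then show ?thesis using that I F1 s2(4) by (auto simp: I_def)
      next
        case True
        then have kt: "k \<in> supp t" using that(4) kS by (auto simp: subset_iff less_Suc_eq)
        show ?thesis
        proof (cases "supp t = insert k S")
          case True
          then show ?thesis using F1(3) s2(4) by auto
        next
          case False
          have "supp t - insert k S = (supp t - S) - {k}" by auto
          then have "card (supp t - insert k S) \<le> e"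
            using that(3) kt kS by simp
          moreover have "supp t - insert k S \<subseteq> {..<k}"
            using True by (auto simp: less_Suc_eq)
          ultimately show ?thesis using s2(5) False that(1) kt by auto
        qed
      qed
      then show ?thesis
        using p mem I F1(2) s2(4) k F3 by (auto simp: I_def)
    qed
    ultimately have "\<exists>s''. yields n f ?body s' (poly (cost e) n + 62) (return_pmf s'') \<and> I k s''"
      by blast
    then show ?thesis using k by simp
  qed
  moreover have "reg s' (9 + 2 * d) = 0" if "I 0 s'" for s'
    using that by (simp add: I_def)
  ultimately obtain s' where s': "I 0 s'"
    "yields n f (WhileNZ (9 + 2 * d) ?body) ?s0 (r * (poly (cost e) n + 62 + 2) + 1) (return_pmf s')"
    using yields_while[of I "9 + 2 * d" n f ?body "poly (cost e) n + 62" r ?s0] by blast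
  have "yields n f (search m (Suc e) d) s (20 + (r * (poly (cost e) n + 62 + 2) + 1) + 1) (return_pmf s')"
    unfolding search.simps by (rule yields_Seq1[OF init s'(2)])
  moreover have "20 + (r * (poly (cost e) n + 62 + 2) + 1) + 1 \<le> poly (cost (Suc e)) n"
    using mult_mono[OF rn, of "poly (cost e) n + 62 + 2" "poly (cost e) n + 100"] by simp
  ultimately have "yields n f (search m (Suc e) d) s (poly (cost (Suc e)) n) (return_pmf s')"
    by (rule yields_mono)
  then show ?case using s'(1) unfolding I_def by blast
qed

section \<open>Uniform numbers and strings from coin tosses\<close>

abbreviation coin :: "bool pmf" where
  "coin \<equiv> bernoulli_pmf (1 / 2)"

lemma yields_coin_then:
  assumes "straight c"
  shows "yields n f (Seq (Coin r) c) s (tm c + 2)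
    (map_pmf (\<lambda>b. ev n f c (set_reg r (of_bool b) s)) coin)"
proof -
  have "yields n f (Coin r) s 1 (map_pmf (\<lambda>b. set_reg r (of_bool b) s) coin)"
    by (simp add: yields_def steps_0 bind_return_pmf' pmf.map_comp o_def)
  then have "yields n f (Seq (Coin r) c) s (1 + tm c + 1)
      (bind_pmf (map_pmf (\<lambda>b. set_reg r (of_bool b) s) coin) (\<lambda>s'. return_pmf (ev n f c s')))"
    by (rule yields_Seq) (rule yields_straight[OF assms])
  then show ?thesis
    by (simp add: map_pmf_def bind_assoc_pmf bind_return_pmf)
qed

lemma pair_pmf_of_set:
  assumes "finite A" "A \<noteq> {}" "finite B" "B \<noteq> {}"
  shows "pair_pmf (pmf_of_set A) (pmf_of_set B) = pmf_of_set (A \<times> B)"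
proof (rule pmf_eqI)
  fix p
  show "pmf (pair_pmf (pmf_of_set A) (pmf_of_set B)) p = pmf (pmf_of_set (A \<times> B)) p"
    using assms by (cases p) (simp add: pmf_pair indicator_def card_cartesian_product)
qed

lemma uniform_double:
  "bind_pmf (pmf_of_set {..<2 ^ K}) (\<lambda>u. map_pmf (\<lambda>b. u + u + of_bool b) coin) =
    pmf_of_set {..<2 ^ Suc K :: nat}"
proof -
  have "0 \<in> {..<2 ^ K :: nat}" by simp
  then have ne: "{..<2 ^ K :: nat} \<noteq> {}" by blast
  have "bind_pmf (pmf_of_set {..<2 ^ K}) (\<lambda>u. map_pmf (\<lambda>b. u + u + of_bool b) coin) =
      map_pmf (\<lambda>(u, b). u + u + of_bool b) (pair_pmf (pmf_of_set {..<2 ^ K}) coin)"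
    by (simp add: pair_pmf_def map_bind_pmf map_pmf_def bind_assoc_pmf bind_return_pmf)
  also have "pair_pmf (pmf_of_set {..<2 ^ K :: nat}) coin = pmf_of_set ({..<2 ^ K} \<times> UNIV)"
    using ne by (simp add: bernoulli_pmf_half_conv_pmf_of_set pair_pmf_of_set)
  also have "map_pmf (\<lambda>(u, b). u + u + of_bool b) \<dots> = pmf_of_set {..<2 ^ Suc K :: nat}"
  proof (rule map_pmf_of_set_bij_betw)
    show "bij_betw (\<lambda>(u, b). u + u + of_bool b) ({..<2 ^ K} \<times> UNIV) {..<2 ^ Suc K :: nat}"
      by (rule bij_betwI[where g = "\<lambda>v. (v div 2, odd v)"])
        (auto simp: of_bool_def split: if_splits, presburger)
  qed (use ne in auto)
  finally show ?thesis .
qed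

text \<open>The last bit is tossed first, matching \<open>fill\<close>, which counts down and writes
  the highest cell first.\<close>

lemma uniform_snoc:
  "bind_pmf coin (\<lambda>b. map_pmf (\<lambda>x. x @ [b]) (pmf_of_set (cube k))) = pmf_of_set (cube (Suc k))"
proof -
  have ne: "cube k \<noteq> {}" by (metis card_cube card.empty power_not_zero zero_neq_numeral)
  have snoc: "length y = Suc k \<Longrightarrow> butlast y @ [last y] = y" for y :: "bool list"
    by (intro append_butlast_last_id) auto
  have "bind_pmf coin (\<lambda>b. map_pmf (\<lambda>x. x @ [b]) (pmf_of_set (cube k))) =
      map_pmf (\<lambda>(b, x). x @ [b]) (pair_pmf coin (pmf_of_set (cube k)))"
    by (simp add: pair_pmf_def map_bind_pmf map_pmf_def bind_assoc_pmf bind_return_pmf)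
  also have "pair_pmf coin (pmf_of_set (cube k)) = pmf_of_set (UNIV \<times> cube k)"
    using ne by (simp add: bernoulli_pmf_half_conv_pmf_of_set pair_pmf_of_set)
  also have "map_pmf (\<lambda>(b, x). x @ [b]) \<dots> = pmf_of_set (cube (Suc k))"
  proof (rule map_pmf_of_set_bij_betw)
    show "bij_betw (\<lambda>(b, x). x @ [b]) (UNIV \<times> cube k) (cube (Suc k))"
      by (rule bij_betwI[where g = "\<lambda>y. (last y, butlast y)"]) (auto simp: cube_def snoc)
  qed (use ne in auto)
  finally show ?thesis .
qed

text \<open>Doubling and adding a fresh bit is Horner's scheme for a random binary number. Only the
  marginal of register 2 is described, as register 4 retains the last coin.\<close>

lemma gen_correct:
  assumes "reg s 2 = 0"
  shows "\<exists>D. yields n f (gen K) s (10 * K) D \<and>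
    map_pmf (\<lambda>s'. reg s' 2) D = pmf_of_set {..<2 ^ K} \<and>
    (\<forall>s'\<in>set_pmf D. mem s' = mem s \<and> (\<forall>r. r \<noteq> 2 \<and> r \<noteq> 4 \<longrightarrow> reg s' r = reg s r))"
proof (induction K)
  case 0
  have "pmf_of_set {..<2 ^ 0 :: nat} = return_pmf 0"
    by (simp add: lessThan_Suc pmf_of_set_singleton)
  then show ?case
    using assms by (intro exI[of _ "return_pmf s"]) simp
next
  case (Suc K)
  then obtain D where D: "yields n f (gen K) s (10 * K) D"
    "map_pmf (\<lambda>s'. reg s' 2) D = pmf_of_set {..<2 ^ K}"
    "\<And>s' r. s' \<in> set_pmf D \<Longrightarrow> mem s' = mem s \<and> (r \<noteq> 2 \<and> r \<noteq> 4 \<longrightarrow> reg s' r = reg s r)"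
    by blast
  let ?c = "blk [Add 2 2 2, Add 2 2 4]"
  let ?E = "\<lambda>s'. map_pmf (\<lambda>b. ev n f ?c (set_reg 4 (of_bool b) s')) coin"
  have "yields n f (gen (Suc K)) s (10 * K + (tm ?c + 2) + 1) (bind_pmf D ?E)"
    unfolding gen.simps by (intro yields_Seq[OF D(1)] yields_coin_then) simp
  then have Y: "yields n f (gen (Suc K)) s (10 * Suc K) (bind_pmf D ?E)"
    by (rule yields_mono) simp
  have "map_pmf (\<lambda>s'. reg s' 2) (bind_pmf D ?E) =
      bind_pmf (map_pmf (\<lambda>s'. reg s' 2) D) (\<lambda>u. map_pmf (\<lambda>b. u + u + of_bool b) coin)"
    by (simp add: map_bind_pmf bind_map_pmf pmf.map_comp o_def set_reg_def)
  also have "\<dots> = pmf_of_set {..<2 ^ Suc K}"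
    unfolding D(2) by (rule uniform_double)
  finally show ?case
    using Y D(3) by (intro exI[of _ "bind_pmf D ?E"]) (auto simp: set_reg_def)
qed

text \<open>Direct induction on the counter, since \<open>yields_while\<close> covers only bodies
  with a deterministic effect.\<close>

lemma fill_correct:
  assumes "reg s 3 = k" "reg s 1 = 1"
  shows "\<exists>D. yields n f fill s (10 * k + 1) D \<and>
    map_pmf (\<lambda>s'. map (\<lambda>i. mem s' i \<noteq> 0) [0..<k]) D = pmf_of_set (cube k) \<and>
    (\<forall>s'\<in>set_pmf D. reg s' 3 = 0 \<and> (\<forall>r. r \<noteq> 3 \<and> r \<noteq> 4 \<longrightarrow> reg s' r = reg s r) \<and>
       (\<forall>j\<ge>k. mem s' j = mem s j) \<and> (\<forall>j<k. mem s' j \<le> 1))"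
  using assms
proof (induction k arbitrary: s)
  case 0
  have "pmf_of_set (cube 0) = return_pmf []"
    by (simp add: cube_def pmf_of_set_singleton)
  moreover have "yields n f fill s 1 (return_pmf s)"
    using 0 unfolding fill_def One_nat_def by (intro yields_step1) auto
  ultimately show ?case
    using 0 by (intro exI[of _ "return_pmf s"]) simp
next
  case (Suc k)
  define P where "P s D \<longleftrightarrow> yields n f fill s (10 * k + 1) D \<and>
    map_pmf (\<lambda>s'. map (\<lambda>i. mem s' i \<noteq> 0) [0..<k]) D = pmf_of_set (cube k) \<and>
    (\<forall>s'\<in>set_pmf D. reg s' 3 = 0 \<and> (\<forall>r. r \<noteq> 3 \<and> r \<noteq> 4 \<longrightarrow> reg s' r = reg s r) \<and>
       (\<forall>j\<ge>k. mem s' j = mem s j) \<and> (\<forall>j<k. mem s' j \<le> 1))" for s D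
  \<comment> \<open>One final distribution is chosen for each start state, so that they can be mixed
    over the coin.\<close>
  have "\<forall>s. \<exists>D. reg s 3 = k \<and> reg s 1 = 1 \<longrightarrow> P s D"
    using Suc.IH unfolding P_def by blast
  then obtain E where E: "\<And>s. reg s 3 = k \<Longrightarrow> reg s 1 = 1 \<Longrightarrow> P s (E s)"
    by metis
  define s\<^sub>1 where "s\<^sub>1 = (\<lambda>b. ev n f (Store 3 4) (set_reg 4 (of_bool b) (set_reg 3 k s)))"
  have s: "reg (s\<^sub>1 b) 3 = k" "reg (s\<^sub>1 b) 1 = 1" "mem (s\<^sub>1 b) = (mem s)(k := of_bool b)"
    "\<And>r. r \<noteq> 3 \<Longrightarrow> r \<noteq> 4 \<Longrightarrow> reg (s\<^sub>1 b) r = reg s r" for b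
    using Suc.prems by (auto simp: s\<^sub>1_def set_reg_def)
  note PE = E[OF s(1,2), unfolded P_def]
  have "yields n f (Sub 3 3 1) s 1 (return_pmf (set_reg 3 k s))"
    using yields_straight[of "Sub 3 3 1" n f s] Suc.prems by simp
  then have "yields n f (Seq (Sub 3 3 1) (Seq (Coin 4) (Store 3 4))) s (1 + (tm (Store 3 4) + 2) + 1)
      (map_pmf s\<^sub>1 coin)"
    unfolding s\<^sub>1_def by (rule yields_Seq1) (rule yields_coin_then, simp)
  then have "yields n f (Seq (Seq (Sub 3 3 1) (Seq (Coin 4) (Store 3 4))) fill) s
      (1 + (tm (Store 3 4) + 2) + 1 + (10 * k + 1) + 1) (bind_pmf (map_pmf s\<^sub>1 coin) E)"
  proof (rule yields_Seq)
    fix s' assume "s' \<in> set_pmf (map_pmf s\<^sub>1 coin)"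
    then obtain b where "s' = s\<^sub>1 b" unfolding set_map_pmf by blast
    then show "yields n f fill s' (10 * k + 1) (E s')" using PE by blast
  qed
  then have "yields n f fill s (Suc (1 + (tm (Store 3 4) + 2) + 1 + (10 * k + 1) + 1))
      (bind_pmf (map_pmf s\<^sub>1 coin) E)"
    using Suc.prems unfolding fill_def by (intro yields_step1) auto
  then have Y: "yields n f fill s (10 * Suc k + 1) (bind_pmf (map_pmf s\<^sub>1 coin) E)"
    by (rule yields_mono) simp
  have "map_pmf (\<lambda>s'. map (\<lambda>i. mem s' i \<noteq> 0) [0..<Suc k]) (bind_pmf (map_pmf s\<^sub>1 coin) E) =
      bind_pmf coin (\<lambda>b. map_pmf (\<lambda>s'. map (\<lambda>i. mem s' i \<noteq> 0) [0..<Suc k]) (E (s\<^sub>1 b)))"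
    by (simp only: map_bind_pmf bind_map_pmf)
  also have "\<dots> = bind_pmf coin (\<lambda>b. map_pmf (\<lambda>x. x @ [b])
      (map_pmf (\<lambda>s'. map (\<lambda>i. mem s' i \<noteq> 0) [0..<k]) (E (s\<^sub>1 b))))"
  proof (intro bind_pmf_cong refl)
    fix b
    \<comment> \<open>The remaining iterations write only below \<open>k\<close>, so cell
      \<open>k\<close> keeps the bit tossed first.\<close>
    have "mem s' k = of_bool b" if "s' \<in> set_pmf (E (s\<^sub>1 b))" for s'
    proof -
      have "mem s' k = mem (s\<^sub>1 b) k" using PE that by blast
      then show ?thesis by (simp add: s(3))
    qed
    then show "map_pmf (\<lambda>s'. map (\<lambda>i. mem s' i \<noteq> 0) [0..<Suc k]) (E (s\<^sub>1 b)) =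
        map_pmf (\<lambda>x. x @ [b]) (map_pmf (\<lambda>s'. map (\<lambda>i. mem s' i \<noteq> 0) [0..<k]) (E (s\<^sub>1 b)))"
      unfolding pmf.map_comp by (intro map_pmf_cong) auto
  qed
  also have "\<dots> = bind_pmf coin (\<lambda>b. map_pmf (\<lambda>x. x @ [b]) (pmf_of_set (cube k)))"
    unfolding PE[THEN conjunct2, THEN conjunct1] ..
  also have "\<dots> = pmf_of_set (cube (Suc k))"
    by (rule uniform_snoc)
  finally have M: "map_pmf (\<lambda>s'. map (\<lambda>i. mem s' i \<noteq> 0) [0..<Suc k]) (bind_pmf (map_pmf s\<^sub>1 coin) E) =
    pmf_of_set (cube (Suc k))" .
  have "reg s' 3 = 0 \<and> (\<forall>r. r \<noteq> 3 \<and> r \<noteq> 4 \<longrightarrow> reg s' r = reg s r) \<and>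
       (\<forall>j\<ge>Suc k. mem s' j = mem s j) \<and> (\<forall>j<Suc k. mem s' j \<le> 1)"
    if "s' \<in> set_pmf (bind_pmf (map_pmf s\<^sub>1 coin) E)" for s'
  proof -
    obtain b where b: "s' \<in> set_pmf (E (s\<^sub>1 b))"
      using \<open>s' \<in> set_pmf (bind_pmf (map_pmf s\<^sub>1 coin) E)\<close> by (auto simp only: set_bind_pmf set_map_pmf)
    then have s': "reg s' 3 = 0" "\<And>r. r \<noteq> 3 \<and> r \<noteq> 4 \<Longrightarrow> reg s' r = reg (s\<^sub>1 b) r"
      "\<And>j. j \<ge> k \<Longrightarrow> mem s' j = mem (s\<^sub>1 b) j" "\<And>j. j < k \<Longrightarrow> mem s' j \<le> 1"
      using PE by blast+
    have "mem s' j \<le> 1" if "j < Suc k" for j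
      using s'(3,4)[of j] s(3)[of b] that by (cases "j = k") auto
    moreover have "mem s' j = mem s j" if "j \<ge> Suc k" for j
      using s'(3)[of j] s(3)[of b] that by simp
    ultimately show ?thesis
      using s'(1) s'(2) s(4)[of _ b] by simp
  qed
  with Y M show ?case by blast
qed

section \<open>Assembling the sampler from a random and a deterministic phase\<close>

definition prepare :: "nat \<Rightarrow> program" where
  "prepare K = Seq (gen K) (Seq (blk [Const 1 1, Add 3 0 3]) fill)"

text \<open>Cells from \<open>n\<close> on are still 0 when \<open>Query 0 0\<close> runs, so answer
  0 becomes \<open>f\<close> at the zero string. Register 3 is 0 as well, so
  \<open>Add 7 0 3\<close> makes \<open>n\<close> the index bound at the root.\<close>

definition analyse :: "(nat \<Rightarrow> nat) \<Rightarrow> nat \<Rightarrow> program" where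
  "analyse m c = Seq (blk [Query 0 0, Add 7 0 3]) (Seq (search m c 0) finish)"

definition ready :: "nat \<Rightarrow> 'y state \<Rightarrow> bool" where
  "ready n s \<longleftrightarrow> reg s 0 = n \<and> reg s 1 = 1 \<and> reg s 3 = 0 \<and> reg s 6 = 0 \<and>
     (\<forall>j\<ge>n. mem s j = 0) \<and> (\<forall>j<n. mem s j \<le> 1)"

lemma prepare_correct:
  fixes f :: "bool list \<Rightarrow> 'y"
  shows "\<exists>D. yields n f (prepare K) (init_state n) (10 * K + 10 * n + 30) D \<and>
    map_pmf (\<lambda>s. (reg s 2, read_bits n 0 s)) D =
      pair_pmf (pmf_of_set {..<2 ^ K}) (pmf_of_set (cube n)) \<and>
    (\<forall>s\<in>set_pmf D. ready n s)"
proof -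
  let ?i = "init_state n :: 'y state"
  have "reg ?i 2 = 0" by (simp add: init_state_def)
  from gen_correct[OF this, of n f K] obtain D where
    D: "yields n f (gen K) ?i (10 * K) D" "map_pmf (\<lambda>s'. reg s' 2) D = pmf_of_set {..<2 ^ K}"
    "\<And>s' r. s' \<in> set_pmf D \<Longrightarrow> mem s' = mem ?i \<and> (r \<noteq> 2 \<and> r \<noteq> 4 \<longrightarrow> reg s' r = reg ?i r)"
    by blast
  let ?c = "blk [Const 1 1, Add 3 0 3]"
  define P where "P s D \<longleftrightarrow> yields n f fill s (10 * n + 1) D \<and>
    map_pmf (\<lambda>s'. map (\<lambda>i. mem s' i \<noteq> 0) [0..<n]) D = pmf_of_set (cube n) \<and>
    (\<forall>s'\<in>set_pmf D. reg s' 3 = 0 \<and> (\<forall>r. r \<noteq> 3 \<and> r \<noteq> 4 \<longrightarrow> reg s' r = reg s r) \<and>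
       (\<forall>j\<ge>n. mem s' j = mem s j) \<and> (\<forall>j<n. mem s' j \<le> 1))" for s D
  have "\<forall>s. \<exists>D. reg s 3 = n \<and> reg s 1 = 1 \<longrightarrow> P s D"
    using fill_correct unfolding P_def by blast
  then obtain E where E: "\<And>s. reg s 3 = n \<Longrightarrow> reg s 1 = 1 \<Longrightarrow> P s (E s)"
    by metis
  let ?E = "\<lambda>s. E (ev n f ?c s)"
  have P: "P (ev n f ?c s) (?E s)" if "s \<in> set_pmf D" for s
    using D(3)[OF that] by (intro E) (simp_all add: set_reg_def init_state_def)
  note PM = P[unfolded P_def, THEN conjunct2, THEN conjunct1]
  have PR: "reg s' 3 = 0" "n \<le> j \<Longrightarrow> mem s' j = mem s j" "j < n \<Longrightarrow> mem s' j \<le> 1"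
    "r \<noteq> 1 \<Longrightarrow> r \<noteq> 3 \<Longrightarrow> r \<noteq> 4 \<Longrightarrow> reg s' r = reg s r" "reg s' 1 = 1"
    if "s \<in> set_pmf D" "s' \<in> set_pmf (?E s)" for s s' j r
  proof -
    have Q: "reg s' 3 = 0" "\<And>r. r \<noteq> 3 \<and> r \<noteq> 4 \<Longrightarrow> reg s' r = reg (ev n f ?c s) r"
      "\<And>j. j \<ge> n \<Longrightarrow> mem s' j = mem (ev n f ?c s) j" "\<And>j. j < n \<Longrightarrow> mem s' j \<le> 1"
      using P[OF that(1)] that(2) unfolding P_def by blast+
    show "reg s' 3 = 0" "j < n \<Longrightarrow> mem s' j \<le> 1" by (rule Q(1), rule Q(4))
    show "n \<le> j \<Longrightarrow> mem s' j = mem s j"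
      using Q(3)[of j] by (simp add: set_reg_def)
    show "r \<noteq> 1 \<Longrightarrow> r \<noteq> 3 \<Longrightarrow> r \<noteq> 4 \<Longrightarrow> reg s' r = reg s r" "reg s' 1 = 1"
      using Q(2)[of r] Q(2)[of 1] by (simp_all add: set_reg_def)
  qed
  have "yields n f (prepare K) ?i (10 * K + (20 + (10 * n + 1) + 1) + 1) (bind_pmf D ?E)"
    unfolding prepare_def
  proof (rule yields_Seq[OF D(1)])
    fix s assume s: "s \<in> set_pmf D"
    have "yields n f ?c s 20 (return_pmf (ev n f ?c s))"
      by (rule yields_straight_le) simp_all
    then show "yields n f (Seq ?c fill) s (20 + (10 * n + 1) + 1) (?E s)"
      by (rule yields_Seq1) (rule P[OF s, unfolded P_def, THEN conjunct1])
  qed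
  then have Y: "yields n f (prepare K) ?i (10 * K + 10 * n + 30) (bind_pmf D ?E)"
    by (rule yields_mono) simp
  \<comment> \<open>From every state left by \<open>gen\<close> the string comes out uniform, which
    makes it independent of \<open>u\<close>.\<close>
  have "map_pmf (\<lambda>s. (reg s 2, read_bits n 0 s)) (bind_pmf D ?E) =
      bind_pmf D (\<lambda>s. map_pmf (Pair (reg s 2)) (pmf_of_set (cube n)))"
    unfolding map_bind_pmf
  proof (rule bind_pmf_cong[OF refl])
    fix s assume s: "s \<in> set_pmf D"
    have "map_pmf (\<lambda>s. (reg s 2, read_bits n 0 s)) (?E s) =
        map_pmf (\<lambda>s'. (reg s 2, map (\<lambda>i. mem s' i \<noteq> 0) [0..<n])) (?E s)"
    proof (rule map_pmf_cong[OF refl])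
      fix s' assume "s' \<in> set_pmf (?E s)"
      from PR(4)[OF s this, of 2]
      show "(reg s' 2, read_bits n 0 s') = (reg s 2, map (\<lambda>i. mem s' i \<noteq> 0) [0..<n])"
        by (simp add: read_bits_def)
    qed
    also have "\<dots> = map_pmf (Pair (reg s 2)) (map_pmf (\<lambda>s'. map (\<lambda>i. mem s' i \<noteq> 0) [0..<n]) (?E s))"
      unfolding pmf.map_comp o_def ..
    finally show "map_pmf (\<lambda>s. (reg s 2, read_bits n 0 s)) (?E s) =
        map_pmf (Pair (reg s 2)) (pmf_of_set (cube n))"
      unfolding PM[OF s] .
  qed
  also have "\<dots> = pair_pmf (map_pmf (\<lambda>s'. reg s' 2) D) (pmf_of_set (cube n))"
    by (simp add: pair_pmf_def map_pmf_def bind_assoc_pmf bind_return_pmf)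
  finally have M: "map_pmf (\<lambda>s. (reg s 2, read_bits n 0 s)) (bind_pmf D ?E) =
      pair_pmf (pmf_of_set {..<2 ^ K}) (pmf_of_set (cube n))"
    unfolding D(2) .
  have "ready n s'" if s': "s' \<in> set_pmf (bind_pmf D ?E)" for s'
  proof -
    obtain s where s: "s \<in> set_pmf D" "s' \<in> set_pmf (?E s)"
      using s' unfolding set_bind_pmf by blast
    show ?thesis
      unfolding ready_def using PR[OF s] D(3)[OF s(1)]
      by (simp add: init_state_def)
  qed
  with Y M show ?thesis by blast
qed

definition flip_at :: "nat \<Rightarrow> bool list \<Rightarrow> bool list" where
  "flip_at i x = x[i := \<not> x ! i]"

text \<open>The deterministic map that \<open>analyse\<close> applies to the random pair drawn by
  \<open>prepare\<close>.\<close>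

definition outcome :: "(nat \<Rightarrow> nat) \<Rightarrow> bool list \<Rightarrow> nat \<times> bool list \<Rightarrow> bool list" where
  "outcome m t = (\<lambda>(u, x). case verdict m t x u of 0 \<Rightarrow> x | Suc i \<Rightarrow> flip_at i x)"

lemma verdict_Suc_less:
  assumes "t \<in> cube n" "verdict m t x u = Suc i" "m 0 = 0"
  shows "i < n"
proof -
  have "supp t \<noteq> {}" "i = Min (supp t)"
    using assms by (auto simp: verdict_def split: if_splits)
  then show ?thesis
    using Min_in[of "supp t"] assms(1) by (simp add: supp_def cube_def)
qed

lemma finish_correct:
  assumes "reg s 1 = 1" "\<forall>i<n. mem s i = of_bool (x ! i)" "x \<in> cube n" "reg s 3 \<le> n"
  shows "\<exists>s'. yields n f finish s 20 (return_pmf s') \<and>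
    read_bits n 0 s' = (case reg s 3 of 0 \<Rightarrow> x | Suc i \<Rightarrow> flip_at i x)"
proof (intro exI conjI)
  show "yields n f finish s 20 (return_pmf (ev n f finish s))"
    by (rule yields_straight_le) (simp_all add: finish_def)
  show "read_bits n 0 (ev n f finish s) = (case reg s 3 of 0 \<Rightarrow> x | Suc i \<Rightarrow> flip_at i x)"
    using assms by (cases "reg s 3")
      (auto simp: finish_def read_bits_def set_reg_def cube_def flip_at_def nth_list_update
        intro!: nth_equalityI)
qed

lemma analyse_correct:
  assumes "simon_promise n f t" "ready n s" "m 0 = 0" "\<forall>d>c. m d = 0"
  shows "\<exists>s'. yields n f (analyse m c) s (poly (cost c) n + 50) (return_pmf s') \<and>
    read_bits n 0 s' = outcome m t (reg s 2, read_bits n 0 s)"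
proof -
  let ?x = "read_bits n 0 s" and ?s1 = "ev n f (blk [Query 0 0, Add 7 0 3]) s"
  let ?v = "verdict m t ?x (reg s 2)"
  have t: "t \<in> cube n" "supp t \<subseteq> {..<n}"
    using assms(1) by (auto simp: simon_promise_def cube_def supp_def)
  have "mem s i = of_bool (mem s i \<noteq> 0)" if "i < n" for i
    using assms(2) that by (auto simp: ready_def le_Suc_eq)
  then have bits: "\<forall>i<n. mem s i = of_bool (?x ! i)"
    by (simp add: read_bits_def)
  have "read_bits n n s = replicate n False"
    using assms(2) by (auto simp: read_bits_def ready_def intro!: nth_equalityI)
  then have node: "at_node n f ?x (reg s 2) 0 n {} ?s1"
    using assms(2) bits by (simp add: at_node_def set_reg_def ready_def)
  have F: "reg ?s1 3 = 0"
    using assms(2) by (simp add: set_reg_def ready_def)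
  then have "reg ?s1 3 = 0 \<or> reg ?s1 3 = ?v" ..
  from search_correct[OF assms(1) node this, of c] obtain s2 where
    s2: "yields n f (search m c 0) ?s1 (poly (cost c) n) (return_pmf s2)"
      "preserves 0 ?s1 s2" "mem s2 = mem ?s1" "reg s2 3 = 0 \<or> reg s2 3 = ?v"
      "supp t \<noteq> {} \<Longrightarrow> card (supp t) \<le> c \<Longrightarrow> reg s2 3 = ?v"
    using t F by auto
  have s23: "reg s2 3 = ?v"
  proof (cases "supp t \<noteq> {} \<and> card (supp t) \<le> c")
    \<comment> \<open>If \<open>t\<close> is zero or has more than \<open>c\<close> ones,
      \<open>m\<close> vanishes at its weight. The verdict is then 0, the value register 3 starts
      with.\<close>
    case False
    then have "?v = 0" using assms(3,4) by (auto simp: verdict_def)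
    then show ?thesis using s2(4) by auto
  qed (use s2 in auto)
  have le: "?v \<le> n"
    using verdict_Suc_less[where m = m, OF t(1) _ assms(3), of ?x "reg s 2"] by (cases ?v) auto
  have "\<exists>s'. yields n f finish s2 20 (return_pmf s') \<and>
    read_bits n 0 s' = (case reg s2 3 of 0 \<Rightarrow> ?x | Suc i \<Rightarrow> flip_at i ?x)"
  proof (rule finish_correct)
    show "reg s2 1 = 1" using s2(2) node by (simp add: preserves_def at_node_def)
    show "\<forall>i<n. mem s2 i = of_bool (?x ! i)" using s2(3) bits by (simp add: set_reg_def)
  qed (use s23 le in \<open>auto simp: cube_def read_bits_def\<close>)
  then obtain s3 where s3: "yields n f finish s2 20 (return_pmf s3)"
    "read_bits n 0 s3 = outcome m t (reg s 2, ?x)"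
    unfolding s23 outcome_def by auto
  have "yields n f (analyse m c) s (20 + (poly (cost c) n + 20 + 1) + 1) (return_pmf s3)"
    unfolding analyse_def
    by (intro yields_Seq1[OF yields_straight_le yields_Seq1[OF s2(1) s3(1)]]) auto
  then have "yields n f (analyse m c) s (poly (cost c) n + 50) (return_pmf s3)"
    by (rule yields_mono) simp
  then show ?thesis using s3(2) by blast
qed

lemma sampler_correct:
  assumes "simon_promise n f t" "m 0 = 0" "\<forall>d>c. m d = 0"
    and "T \<ge> 10 * K + 10 * n + poly (cost c) n + 100"
  shows "halts_within n f (Seq (prepare K) (analyse m c)) T"
    and "sampled n f (Seq (prepare K) (analyse m c)) T =
      map_pmf (outcome m t) (pair_pmf (pmf_of_set {..<2 ^ K}) (pmf_of_set (cube n)))"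
proof -
  obtain D where D: "yields n f (prepare K) (init_state n) (10 * K + 10 * n + 30) D"
    "map_pmf (\<lambda>s. (reg s 2, read_bits n 0 s)) D =
      pair_pmf (pmf_of_set {..<2 ^ K}) (pmf_of_set (cube n))"
    "\<And>s. s \<in> set_pmf D \<Longrightarrow> ready n s"
    using prepare_correct by blast
  have "\<forall>s. \<exists>s'. ready n s \<longrightarrow> yields n f (analyse m c) s (poly (cost c) n + 50) (return_pmf s') \<and>
    read_bits n 0 s' = outcome m t (reg s 2, read_bits n 0 s)"
    using analyse_correct[where m = m and c = c, OF assms(1) _ assms(2,3)] by blast
  then obtain h where h: "\<And>s. ready n s \<Longrightarrow>
      yields n f (analyse m c) s (poly (cost c) n + 50) (return_pmf (h s))"
    "\<And>s. ready n s \<Longrightarrow> read_bits n 0 (h s) = outcome m t (reg s 2, read_bits n 0 s)"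
    by metis
  have "yields n f (Seq (prepare K) (analyse m c)) (init_state n)
      (10 * K + 10 * n + 30 + (poly (cost c) n + 50) + 1) (bind_pmf D (\<lambda>s. return_pmf (h s)))"
    by (intro yields_Seq[OF D(1)] h D(3))
  then have Y: "yields n f (Seq (prepare K) (analyse m c)) (init_state n) T (map_pmf h D)"
    unfolding map_pmf_def[symmetric] by (rule yields_mono) (use assms(4) in simp)
  show "halts_within n f (Seq (prepare K) (analyse m c)) T"
    by (rule halts_within_if_yields[OF Y])
  have "sampled n f (Seq (prepare K) (analyse m c)) T = map_pmf (\<lambda>s. read_bits n 0 (h s)) D"
    unfolding sampled_if_yields[OF Y] by (simp add: pmf.map_comp o_def)
  also have "\<dots> = map_pmf (\<lambda>s. outcome m t (reg s 2, read_bits n 0 s)) D"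
    by (intro map_pmf_cong) (auto simp: h(2) D(3))
  also have "\<dots> = map_pmf (outcome m t) (map_pmf (\<lambda>s. (reg s 2, read_bits n 0 s)) D)"
    by (simp add: pmf.map_comp o_def)
  finally show "sampled n f (Seq (prepare K) (analyse m c)) T =
      map_pmf (outcome m t) (pair_pmf (pmf_of_set {..<2 ^ K}) (pmf_of_set (cube n)))"
    unfolding D(2) .
qed

section \<open>The output distribution of the sampler\<close>

lemma sg_flip_at:
  assumes "x \<in> cube n" "t \<in> cube n" "i \<in> supp t"
  shows "sg t (flip_at i x) = - sg t x"
proof -
  have i: "i < n" "i < length x" using assms by (auto simp: supp_def cube_def)
  have *: "{j \<in> supp t. flip_at i x ! j} =
      (if x ! i then {j \<in> supp t. x ! j} - {i} else insert i {j \<in> supp t. x ! j})"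
    using assms(3) i by (auto simp: flip_at_def nth_list_update split: if_splits)
  show ?thesis
  proof (cases "x ! i")
    case True
    have "card {j \<in> supp t. x ! j} = Suc (card ({j \<in> supp t. x ! j} - {i}))"
      by (rule card.remove) (use True assms(3) in auto)
    then show ?thesis using True * by (simp add: sg_def)
  qed (use * in \<open>simp add: sg_def\<close>)
qed

lemma flip_at_flip_at: "flip_at i (flip_at i x) = x"
  by (cases "i < length x") (auto simp: flip_at_def list_update_beyond)

text \<open>For \<open>u\<close> below the threshold, flipping the strings of sign -1 at one fixed
  support position folds them onto those of sign 1, a two-to-one map. For other \<open>u\<close>
  nothing changes.\<close>

lemma pmf_outcome_uniform:
  assumes "t \<in> cube n" "z \<in> cube n" "m 0 = 0"
  shows "pmf (map_pmf (\<lambda>x. outcome m t (u, x)) (pmf_of_set (cube n))) z =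
    (1 + of_bool (u < m (card (supp t))) * sg t z) / 2 ^ n"
proof -
  have ne: "cube n \<noteq> {}" using assms by auto
  show ?thesis
  proof (cases "u < m (card (supp t))")
    case False
    then have "outcome m t (u, x) = x" for x by (simp add: outcome_def verdict_def)
    then show ?thesis using False assms(2) ne by (simp add: card_cube)
  next
    case True
    then have T: "supp t \<noteq> {}" using assms(3) by (intro notI) simp
    define a where "a = Min (supp t)"
    have a: "a \<in> supp t" using T by (simp add: a_def)
    have g: "outcome m t (u, x) = (if sg t x = 1 then x else flip_at a x)" for x
      using True by (simp add: outcome_def verdict_def sg_def a_def)
    have cases: "sg t x = 1 \<or> sg t x = -1" for x by (simp add: sg_def)
    note flip = sg_flip_at[OF _ assms(1) a]
    have fz: "flip_at a z \<in> cube n" using assms(2) by (simp add: cube_def flip_at_def)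
    have "cube n \<inter> (\<lambda>x. outcome m t (u, x)) -` {z} = (if sg t z = 1 then {z, flip_at a z} else {})"
    proof (cases "sg t z = 1")
      case z: True
      have "x = z \<or> x = flip_at a z" if "x \<in> cube n" "outcome m t (u, x) = z" for x
        using that flip_at_flip_at[of a x] by (auto simp: g split: if_splits)
      moreover have "outcome m t (u, flip_at a z) = z" "outcome m t (u, z) = z"
        using flip[OF assms(2)] z by (simp_all add: g flip_at_flip_at)
      ultimately show ?thesis using z fz assms(2) by auto
    next
      case z: False
      have "sg t (outcome m t (u, x)) = 1" if "x \<in> cube n" for x
        using flip[OF that] cases[of x] by (auto simp: g)
      then show ?thesis using z by auto
    qed
    moreover have "flip_at a z \<noteq> z"
      using flip[OF assms(2)] cases[of z] by (metis one_neq_neg_one add.inverse_inverse)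
    ultimately have "card (cube n \<inter> (\<lambda>x. outcome m t (u, x)) -` {z}) = (if sg t z = 1 then 2 else 0)"
      by auto
    then have "pmf (map_pmf (\<lambda>x. outcome m t (u, x)) (pmf_of_set (cube n))) z =
        (if sg t z = 1 then 2 else 0) / 2 ^ n"
      using ne by (simp add: pmf_map measure_pmf_of_set card_cube)
    then show ?thesis using True cases[of z] by auto
  qed
qed

text \<open>Averaging over \<open>u\<close>: exactly \<open>m (card (supp t))\<close> of the
  \<open>2 ^ K\<close> values lie below the threshold, and this fraction becomes the Fourier
  coefficient.\<close>

lemma pmf_outcome:
  assumes "t \<in> cube n" "z \<in> cube n" "m 0 = 0" "m (card (supp t)) \<le> 2 ^ K"
  shows "pmf (map_pmf (outcome m t) (pair_pmf (pmf_of_set {..<2 ^ K}) (pmf_of_set (cube n)))) z =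
    (1 + real (m (card (supp t))) / 2 ^ K * sg t z) / 2 ^ n"
proof -
  let ?M = "m (card (supp t))"
  have "0 \<in> {..<2 ^ K :: nat}" by simp
  then have ne: "{..<2 ^ K :: nat} \<noteq> {}" by blast
  have "map_pmf (outcome m t) (pair_pmf (pmf_of_set {..<2 ^ K}) (pmf_of_set (cube n))) =
      bind_pmf (pmf_of_set {..<2 ^ K}) (\<lambda>u. map_pmf (\<lambda>x. outcome m t (u, x)) (pmf_of_set (cube n)))"
    by (simp add: pair_pmf_def map_bind_pmf map_pmf_def bind_assoc_pmf bind_return_pmf)
  then have "pmf (map_pmf (outcome m t) (pair_pmf (pmf_of_set {..<2 ^ K}) (pmf_of_set (cube n)))) z =
      (\<Sum>u<2 ^ K. (1 + of_bool (u < ?M) * sg t z) / 2 ^ n) / 2 ^ K"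
    using ne by (simp add: pmf_bind pmf_outcome_uniform[where m = m, OF assms(1-3)]
        integral_pmf_of_set sum_divide_distrib[symmetric] mult.commute)
  also have "(\<Sum>u<2 ^ K. (1 + of_bool (u < ?M) * sg t z) / 2 ^ n) =
      (2 ^ K + (\<Sum>u<2 ^ K. of_bool (u < ?M)) * sg t z) / 2 ^ n"
    by (simp add: sum_divide_distrib[symmetric] sum.distrib sum_distrib_right)
  also have "(\<Sum>u<2 ^ K. of_bool (u < ?M) :: real) = real ?M"
  proof -
    have "{..<2 ^ K} \<inter> {u. u < ?M} = {..<?M}" using assms(4) by auto
    then show ?thesis by simp
  qed
  finally show ?thesis by (simp add: field_simps)
qed

section \<open>Approximating the damping factor and fixing the constants\<close>

lemma dyadic_approx:
  fixes y :: real
  assumes "0 \<le> y" "y \<le> 1"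
  shows "nat \<lfloor>y * 2 ^ K\<rfloor> \<le> 2 ^ K" "\<bar>real (nat \<lfloor>y * 2 ^ K\<rfloor>) / 2 ^ K - y\<bar> \<le> (1 / 2) ^ K"
proof -
  have "y * 2 ^ K \<le> 2 ^ K" using assms by simp
  then have "\<lfloor>y * 2 ^ K\<rfloor> \<le> \<lfloor>2 ^ K :: real\<rfloor>" by (rule floor_mono)
  then show "nat \<lfloor>y * 2 ^ K\<rfloor> \<le> 2 ^ K" by (simp add: nat_le_iff)
  have "real (nat \<lfloor>y * 2 ^ K\<rfloor>) = of_int \<lfloor>y * 2 ^ K\<rfloor>" using assms by simp
  then have "\<bar>real (nat \<lfloor>y * 2 ^ K\<rfloor>) - y * 2 ^ K\<bar> \<le> 1" by linarith
  then have "\<bar>real (nat \<lfloor>y * 2 ^ K\<rfloor>) - y * 2 ^ K\<bar> / 2 ^ K \<le> 1 / 2 ^ K"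
    by (rule divide_right_mono) simp
  moreover have "\<bar>real (nat \<lfloor>y * 2 ^ K\<rfloor>) - y * 2 ^ K\<bar> / 2 ^ K =
      \<bar>(real (nat \<lfloor>y * 2 ^ K\<rfloor>) - y * 2 ^ K) / 2 ^ K\<bar>"
    by (simp only: abs_divide power_abs abs_numeral)
  moreover have "(real (nat \<lfloor>y * 2 ^ K\<rfloor>) - y * 2 ^ K) / 2 ^ K = real (nat \<lfloor>y * 2 ^ K\<rfloor>) / 2 ^ K - y"
    by (simp add: diff_divide_distrib)
  ultimately show "\<bar>real (nat \<lfloor>y * 2 ^ K\<rfloor>) / 2 ^ K - y\<bar> \<le> (1 / 2) ^ K"
    by (simp only: power_one_over)
qed

theorem mainTheorem5:
  fixes \<epsilon> \<delta> :: real
  assumes "0 < \<epsilon>" "\<epsilon> \<le> 1" "0 < \<delta>"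
  shows "\<exists>(A :: program) (q :: nat poly). \<forall>(n :: nat) (f :: bool list \<Rightarrow> 'y) (t :: bool list).
    simon_promise n f t \<longrightarrow>
      halts_within n f A (poly q n) \<and>
      (\<Sum>x\<in>cube n. \<bar>pmf (sampled n f A (poly q n)) x - noisy_simon_output \<epsilon> n f x\<bar>) \<le> \<delta>"
proof -
  \<comment> \<open>Cut-off for the weight: beyond \<open>c\<close> the damped coefficient is small
    enough to be dropped.\<close>
  obtain c where c: "(1 - \<epsilon>) ^ c < \<delta>"
    using real_arch_pow_inv[of \<delta> "1 - \<epsilon>"] assms by auto
  \<comment> \<open>Precision of the dyadic rounding. Like \<open>c\<close>, \<open>K\<close>
    depends only on \<open>\<epsilon>\<close> and \<open>\<delta>\<close>, so one program and one
    polynomial serve all \<open>n\<close> and \<open>f\<close>.\<close>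
  obtain K where K: "(1 / 2) ^ K < \<delta>"
    using real_arch_pow_inv[of \<delta> "1 / 2"] assms by auto
  define m where "m d = (if d = 0 \<or> d > c then 0 else nat \<lfloor>(1 - \<epsilon>) ^ d * 2 ^ K\<rfloor>)" for d
  let ?A = "Seq (prepare K) (analyse m c)"
  let ?q = "cost c + [:10 * K + 100, 10:]"
  have pw: "0 \<le> (1 - \<epsilon>) ^ d" "(1 - \<epsilon>) ^ d \<le> 1" for d
    using assms by (auto intro: power_le_one)
  have m: "m 0 = 0" "\<forall>d>c. m d = 0" "m d \<le> 2 ^ K" for d
    using dyadic_approx(1)[OF pw] by (auto simp: m_def)
  \<comment> \<open>Each weight suffers either truncation or rounding, never both, so the full
    \<open>\<delta>\<close> is available for each.\<close>
  have close: "\<bar>real (m d) / 2 ^ K - of_bool (d \<noteq> 0) * (1 - \<epsilon>) ^ d\<bar> \<le> \<delta>" for d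
  proof -
    consider "d = 0" | "d > c" | "d \<noteq> 0" "d \<le> c" by linarith
    then show ?thesis
    proof cases
      case 2
      have "(1 - \<epsilon>) ^ d \<le> (1 - \<epsilon>) ^ c"
        using 2 assms by (intro power_decreasing) auto
      then show ?thesis using 2 c pw[of d] by (simp add: m_def)
    next
      case 3
      then show ?thesis using dyadic_approx(2)[OF pw, of d K] K by (simp add: m_def)
    qed (use assms in \<open>simp add: m_def\<close>)
  qed
  have "halts_within n f ?A (poly ?q n) \<and>
      (\<Sum>x\<in>cube n. \<bar>pmf (sampled n f ?A (poly ?q n)) x - noisy_simon_output \<epsilon> n f x\<bar>) \<le> \<delta>"
    if prom: "simon_promise n f t" for n and f :: "bool list \<Rightarrow> 'y" and t
  proof
    have time: "10 * K + 10 * n + poly (cost c) n + 100 \<le> poly ?q n" by simp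
    show "halts_within n f ?A (poly ?q n)"
      by (rule sampler_correct(1)[where m = m and c = c, OF prom m(1,2) time])
    note sampled = sampler_correct(2)[where m = m and c = c, OF prom m(1,2) time]
    have t: "t \<in> cube n" using prom by (simp add: simon_promise_def)
    let ?M = "real (m (card (supp t))) / 2 ^ K" and ?L = "of_bool (supp t \<noteq> {}) * (1 - \<epsilon>) ^ card (supp t)"
    \<comment> \<open>The two distributions differ only in the coefficient of a character of
      absolute value 1. All \<open>2 ^ n\<close> terms are therefore equal and cancel the
      normalisation.\<close>
    have "(\<Sum>x\<in>cube n. \<bar>pmf (sampled n f ?A (poly ?q n)) x - noisy_simon_output \<epsilon> n f x\<bar>) =
        (\<Sum>x\<in>cube n. \<bar>?M - ?L\<bar> / 2 ^ n)"
    proof (intro sum.cong refl)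
      fix x assume x: "x \<in> cube n"
      have "pmf (sampled n f ?A (poly ?q n)) x = (1 + ?M * sg t x) / 2 ^ n"
        unfolding sampled by (rule pmf_outcome[where m = m, OF t x m(1,3)])
      then have "pmf (sampled n f ?A (poly ?q n)) x - noisy_simon_output \<epsilon> n f x =
          (1 + ?M * sg t x) / 2 ^ n - (1 + ?L * sg t x) / 2 ^ n"
        by (simp only: noisy_simon_output_eq[OF prom x])
      also have "\<dots> = (?M - ?L) / 2 ^ n * sg t x"
        by (simp only: diff_divide_distrib add_divide_distrib left_diff_distrib) simp
      finally have "pmf (sampled n f ?A (poly ?q n)) x - noisy_simon_output \<epsilon> n f x = (?M - ?L) / 2 ^ n * sg t x" .
      moreover have "\<bar>sg t x\<bar> = 1" by (simp add: sg_def)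
      ultimately show "\<bar>pmf (sampled n f ?A (poly ?q n)) x - noisy_simon_output \<epsilon> n f x\<bar> = \<bar>?M - ?L\<bar> / 2 ^ n"
        by (simp only: abs_mult abs_divide) simp
    qed
    also have "\<dots> = \<bar>?M - ?L\<bar>" by (simp add: card_cube)
    also have "\<dots> \<le> \<delta>" using close[of "card (supp t)"] by simp
    finally show "(\<Sum>x\<in>cube n. \<bar>pmf (sampled n f ?A (poly ?q n)) x - noisy_simon_output \<epsilon> n f x\<bar>) \<le> \<delta>" .
  qed
  then show ?thesis by blast
qed

end
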